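(* Let $\mathcal{D}=(D,Q)$ be a discriminant form of even signature, $k\in\mathbb{Z}$, $H_1,\dots,H_n$ arbitrary isotropic subgroups of $D$, and $F\in M_k(\mathcal{D})$. Then $F$ is an oldform with respect to $H_1,\dots,H_n$ (i.e. there exist $G_i\in M_k(\mathcal{D}_{H_i})$ with $F=\sum_{i=1}^n G_i\!\uparrow_{H_i}$) if and only if $\ker(\downarrow)\subseteq\ker(\mathcal{F})$, where $\downarrow=(\downarrow_{H_1},\dots,\downarrow_{H_n}):\mathbb{C}[D]\to\bigoplus_{i=1}^n\mathbb{C}[H_i^\perp/H_i]$ and $\mathcal{F}:\mathbb{C}[D]\to\{\text{functions }\mathbb{H}\to\mathbb{C}\}$ is the $\mathbb{C}$-linear map with $\mathcal{F}(\mathfrak{e}_\gamma)=F_\gamma$.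
   Context: Discriminant form $\mathcal{D}=(D,Q)$: finite abelian group with $Q:D\to\mathbb{Q}/\mathbb{Z}$, $Q(a\gamma)=a^2Q(\gamma)$, and $(\gamma,\delta)=Q(\gamma+\delta)-Q(\gamma)-Q(\delta)$ a nondegenerate bilinear form; signature defined by $\sum_\gamma e(Q(\gamma))=\sqrt{|D|}e(\operatorname{sign}/8)$, $e(x)=\exp(2\pi ix)$. Weil representation $\rho$ on $\mathbb{C}[D]$ (basis $\mathfrak{e}_\gamma$): $\rho(T)\mathfrak{e}_\gamma=e(Q(\gamma))\mathfrak{e}_\gamma$, $\rho(S)\mathfrak{e}_\gamma=\frac{e(-\operatorname{sign}/8)}{\sqrt{|D|}}\sum_\beta e(-(\gamma,\beta))\mathfrak{e}_\beta$. $M_k(\mathcal{D})$: holomorphic $F=\sum_\gamma F_\gamma\mathfrak{e}_\gamma:\mathbb{H}\to\mathbb{C}[D]$ with $F(M\tau)=(c\tau+d)^k\rho(M)F(\tau)$ for all $M\in\mathrm{SL}_2(\mathbb{Z})$, bounded as $\operatorname{Im}\tau\to\infty$. Isotropic subgroup $H$: $Q(H)=0$; $D_H=H^\perp/H$ with $Q_H(\gamma+H)=Q(\gamma)$ is a discriminant form $\mathcal{D}_H$. Algebraic down map $\downarrow_H:\mathbb{C}[D]\to\mathbb{C}[D_H]$: $\mathfrak{e}_\gamma\mapsto\mathfrak{e}_{\gamma+H}$ if $\gamma\in H^\perp$, $\mathfrak{e}_\gamma\mapsto 0$ otherwise. For $G=\sum_\alpha G_\alpha\mathfrak{e}_\alpha\in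 M_k(\mathcal{D}_H)$, $G\!\uparrow_H:=\sum_{\gamma\in H^\perp}G_{\gamma+H}\mathfrak{e}_\gamma$. *)

theory Defs
  imports "HOL-Analysis.Analysis" "HOL-Algebra.Coset"
begin

subsection \<open>The group \<open>\<rat>/\<int>\<close>\<close>

definition qz_rel :: "rat \<Rightarrow> rat \<Rightarrow> bool" where
  "qz_rel x y \<longleftrightarrow> x - y \<in> \<int>"

lemma equivp_qz_rel: "equivp qz_rel"
proof (rule equivpI)
  show "reflp qz_rel"
    by (auto simp: reflp_def qz_rel_def)
  show "symp qz_rel"
    unfolding symp_def qz_rel_def by (metis Ints_minus minus_diff_eq)
  show "transp qz_rel"
    unfolding transp_def qz_rel_def by (metis Ints_add diff_add_cancel add_diff_eq)
qed

quotient_type qz = rat / qz_rel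
  by (rule equivp_qz_rel)

instantiation qz :: ab_group_add
begin

lift_definition zero_qz :: qz is "0 :: rat" .

lift_definition plus_qz :: "qz \<Rightarrow> qz \<Rightarrow> qz" is "(+) :: rat \<Rightarrow> rat \<Rightarrow> rat"
  unfolding qz_rel_def by (metis Ints_add add_diff_add)

lift_definition uminus_qz :: "qz \<Rightarrow> qz" is "uminus :: rat \<Rightarrow> rat"
  unfolding qz_rel_def by (metis Ints_minus minus_diff_minus)

lift_definition minus_qz :: "qz \<Rightarrow> qz \<Rightarrow> qz" is "(-) :: rat \<Rightarrow> rat \<Rightarrow> rat"
  unfolding qz_rel_def by (metis Ints_diff diff_diff_eq2 diff_diff_eq add_diff_eq diff_add_eq add.commute)

instance
  by standard (transfer, simp add: qz_rel_def)+

end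

lift_definition qz_scale :: "int \<Rightarrow> qz \<Rightarrow> qz" is "\<lambda>a x. of_int a * x"
  unfolding qz_rel_def by (metis Ints_mult Ints_of_int right_diff_distrib)

definition ee :: "complex \<Rightarrow> complex" where
  "ee z = exp (2 * of_real pi * \<i> * z)"

lift_definition qz_ee :: "qz \<Rightarrow> complex" is "\<lambda>x. ee (of_rat x)"
proof -
  fix x y :: rat
  assume "qz_rel x y"
  then obtain n :: int where n: "x - y = of_int n"
    unfolding qz_rel_def by (auto elim: Ints_cases)
  then have "x = y + of_int n" by simp
  then have "ee (of_rat x) = exp (2 * of_real pi * \<i> * of_rat y + 2 * of_int n * of_real pi * \<i>)"
    by (simp add: ee_def of_rat_add algebra_simps)
  also have "\<dots> = ee (of_rat y) * exp (2 * of_int n * of_real pi * \<i>)"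
    by (simp only: ee_def exp_add)
  also have "exp (2 * of_int n * of_real pi * \<i>) = (1 :: complex)"
    by (simp add: exp_eq_1)
  finally show "ee (of_rat x) = ee (of_rat y)" by simp
qed

subsection \<open>Discriminant forms\<close>

text \<open>The group is written multiplicatively, as is customary for \<^locale>\<open>comm_group\<close>:
  \<open>\<gamma> \<otimes> \<delta>\<close> is \<open>\<gamma> + \<delta>\<close>, \<open>\<gamma> [^] a\<close> is \<open>a\<gamma>\<close>, and \<open>H #> \<gamma>\<close> is the coset \<open>\<gamma> + H\<close>.\<close>

definition bil :: "('a, 'b) monoid_scheme \<Rightarrow> ('a \<Rightarrow> qz) \<Rightarrow> 'a \<Rightarrow> 'a \<Rightarrow> qz" where
  "bil D Q \<gamma> \<delta> = Q (\<gamma> \<otimes>\<^bsub>D\<^esub> \<delta>) - Q \<gamma> - Q \<delta>"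

definition discriminant_form :: "('a, 'b) monoid_scheme \<Rightarrow> ('a \<Rightarrow> qz) \<Rightarrow> bool" where
  "discriminant_form D Q \<longleftrightarrow>
     comm_group D \<and> finite (carrier D) \<and>
     (\<forall>\<gamma>\<in>carrier D. \<forall>a::int. Q (\<gamma> [^]\<^bsub>D\<^esub> a) = qz_scale (a\<^sup>2) (Q \<gamma>)) \<and>
     (\<forall>\<gamma>\<in>carrier D. \<forall>\<gamma>'\<in>carrier D. \<forall>\<delta>\<in>carrier D.
        bil D Q (\<gamma> \<otimes>\<^bsub>D\<^esub> \<gamma>') \<delta> = bil D Q \<gamma> \<delta> + bil D Q \<gamma>' \<delta> \<and>
        bil D Q \<delta> (\<gamma> \<otimes>\<^bsub>D\<^esub> \<gamma>') = bil D Q \<delta> \<gamma> + bil D Q \<delta> \<gamma>') \<and>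
     (\<forall>\<gamma>\<in>carrier D. (\<forall>\<delta>\<in>carrier D. bil D Q \<gamma> \<delta> = 0) \<longrightarrow> \<gamma> = \<one>\<^bsub>D\<^esub>)"

text \<open>The Gauss sum determines the signature modulo 8 only; \<open>disc_sign\<close> is its representative
  in \<open>{0..<8}\<close>.\<close>

definition is_signature :: "('a, 'b) monoid_scheme \<Rightarrow> ('a \<Rightarrow> qz) \<Rightarrow> int \<Rightarrow> bool" where
  "is_signature D Q s \<longleftrightarrow>
     (\<Sum>\<gamma>\<in>carrier D. qz_ee (Q \<gamma>)) = of_real (sqrt (real (card (carrier D)))) * ee (of_int s / 8)"

definition disc_sign :: "('a, 'b) monoid_scheme \<Rightarrow> ('a \<Rightarrow> qz) \<Rightarrow> int" where
  "disc_sign D Q = (THE s. s \<in> {0..<8} \<and> is_signature D Q s)"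

definition even_signature :: "('a, 'b) monoid_scheme \<Rightarrow> ('a \<Rightarrow> qz) \<Rightarrow> bool" where
  "even_signature D Q \<longleftrightarrow> (\<exists>s. is_signature D Q s \<and> even s)"

definition isotropic_subgroup :: "('a, 'b) monoid_scheme \<Rightarrow> ('a \<Rightarrow> qz) \<Rightarrow> 'a set \<Rightarrow> bool" where
  "isotropic_subgroup D Q H \<longleftrightarrow> subgroup H D \<and> (\<forall>\<gamma>\<in>H. Q \<gamma> = 0)"

definition orth :: "('a, 'b) monoid_scheme \<Rightarrow> ('a \<Rightarrow> qz) \<Rightarrow> 'a set \<Rightarrow> 'a set" where
  "orth D Q H = {\<gamma> \<in> carrier D. \<forall>\<delta>\<in>H. bil D Q \<gamma> \<delta> = 0}"

definition quot_group :: "('a, 'b) monoid_scheme \<Rightarrow> ('a \<Rightarrow> qz) \<Rightarrow> 'a set \<Rightarrow> 'a set monoid" where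
  "quot_group D Q H = (D\<lparr>carrier := orth D Q H\<rparr>) Mod H"

text \<open>For isotropic \<open>H\<close>, \<open>Q\<close> is constant on each coset of \<open>H\<close> contained in \<open>orth D Q H\<close>.\<close>

definition quot_form :: "('a \<Rightarrow> qz) \<Rightarrow> 'a set \<Rightarrow> qz" where
  "quot_form Q \<alpha> = the_elem (Q ` \<alpha>)"

subsection \<open>The Weil representation\<close>

text \<open>Elements of \<open>\<complex>[D]\<close> are coefficient functions vanishing outside the carrier of \<open>D\<close>.\<close>

definition group_alg :: "('a, 'b) monoid_scheme \<Rightarrow> ('a \<Rightarrow> complex) set" where
  "group_alg D = {v. \<forall>\<gamma>. \<gamma> \<notin> carrier D \<longrightarrow> v \<gamma> = 0}"

definition basis_vec :: "'a \<Rightarrow> 'a \<Rightarrow> complex" where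
  "basis_vec \<gamma> = (\<lambda>\<beta>. if \<beta> = \<gamma> then 1 else 0)"

definition SL2Z :: "(int ^ 2 ^ 2) set" where
  "SL2Z = {M. det M = 1}"

definition matT :: "int ^ 2 ^ 2" where
  "matT = vector [vector [1, 1], vector [0, 1]]"

definition matS :: "int ^ 2 ^ 2" where
  "matS = vector [vector [0, -1], vector [1, 0]]"

text \<open>As \<open>S\<close> and \<open>T\<close> generate \<open>SL\<^sub>2(\<int>)\<close>, the following properties determine the
  action of \<open>\<rho>\<close> on \<open>\<complex>[D]\<close>; such a \<open>\<rho>\<close> exists exactly when the signature is even.\<close>

definition weil_representation ::
  "('a, 'b) monoid_scheme \<Rightarrow> ('a \<Rightarrow> qz) \<Rightarrow> (int ^ 2 ^ 2 \<Rightarrow> ('a \<Rightarrow> complex) \<Rightarrow> ('a \<Rightarrow> complex)) \<Rightarrow> bool"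
where
  "weil_representation D Q \<rho> \<longleftrightarrow>
     (\<forall>M\<in>SL2Z. \<forall>v\<in>group_alg D. \<rho> M v \<in> group_alg D) \<and>
     (\<forall>M\<in>SL2Z. \<forall>v\<in>group_alg D. \<forall>w\<in>group_alg D. \<forall>a b.
        \<rho> M (\<lambda>\<gamma>. a * v \<gamma> + b * w \<gamma>) = (\<lambda>\<gamma>. a * \<rho> M v \<gamma> + b * \<rho> M w \<gamma>)) \<and>
     (\<forall>v\<in>group_alg D. \<rho> (mat 1) v = v) \<and>
     (\<forall>M\<in>SL2Z. \<forall>N\<in>SL2Z. \<forall>v\<in>group_alg D. \<rho> (M ** N) v = \<rho> M (\<rho> N v)) \<and>
     (\<forall>\<gamma>\<in>carrier D. \<rho> matT (basis_vec \<gamma>) = (\<lambda>\<delta>. qz_ee (Q \<gamma>) * basis_vec \<gamma> \<delta>)) \<and>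
     (\<forall>\<gamma>\<in>carrier D. \<rho> matS (basis_vec \<gamma>) =
        (\<lambda>\<delta>. ee (- of_int (disc_sign D Q) / 8) / of_real (sqrt (real (card (carrier D)))) *
             (\<Sum>\<beta>\<in>carrier D. qz_ee (- bil D Q \<gamma> \<beta>) * basis_vec \<beta> \<delta>)))"

subsection \<open>Vector-valued modular forms\<close>

definition upper_half_plane :: "complex set" where
  "upper_half_plane = {\<tau>. Im \<tau> > 0}"

definition moebius_act :: "int ^ 2 ^ 2 \<Rightarrow> complex \<Rightarrow> complex" where
  "moebius_act M \<tau> = (of_int (M $ 1 $ 1) * \<tau> + of_int (M $ 1 $ 2)) /
                      (of_int (M $ 2 $ 1) * \<tau> + of_int (M $ 2 $ 2))"

text \<open>A form is a function \<open>F\<close> of \<open>\<tau>\<close> with component \<open>F\<^sub>\<gamma>(\<tau>) = F \<tau> \<gamma>\<close>; its values at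
  \<open>\<tau>\<close> outside the upper half-plane are irrelevant.\<close>

definition modular_forms ::
  "int \<Rightarrow> ('a, 'b) monoid_scheme \<Rightarrow> ('a \<Rightarrow> qz) \<Rightarrow> (complex \<Rightarrow> 'a \<Rightarrow> complex) set" where
  "modular_forms k D Q = {F.
     (\<forall>\<tau>\<in>upper_half_plane. F \<tau> \<in> group_alg D) \<and>
     (\<forall>\<gamma>\<in>carrier D. (\<lambda>\<tau>. F \<tau> \<gamma>) holomorphic_on upper_half_plane) \<and>
     (\<exists>\<rho>. weil_representation D Q \<rho> \<and>
        (\<forall>M\<in>SL2Z. \<forall>\<tau>\<in>upper_half_plane.
           F (moebius_act M \<tau>) =
           (\<lambda>\<gamma>. (of_int (M $ 2 $ 1) * \<tau> + of_int (M $ 2 $ 2)) powi k * \<rho> M (F \<tau>) \<gamma>))) \<and>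
     (\<forall>\<gamma>\<in>carrier D. \<exists>B y. \<forall>\<tau>\<in>upper_half_plane. Im \<tau> \<ge> y \<longrightarrow> norm (F \<tau> \<gamma>) \<le> B)}"

definition down :: "('a, 'b) monoid_scheme \<Rightarrow> ('a \<Rightarrow> qz) \<Rightarrow> 'a set \<Rightarrow> ('a \<Rightarrow> complex) \<Rightarrow> 'a set \<Rightarrow> complex"
where
  "down D Q H v = (\<lambda>\<alpha>. \<Sum>\<gamma>\<in>orth D Q H. v \<gamma> * basis_vec (H #>\<^bsub>D\<^esub> \<gamma>) \<alpha>)"

definition up ::
  "('a, 'b) monoid_scheme \<Rightarrow> ('a \<Rightarrow> qz) \<Rightarrow> 'a set \<Rightarrow> (complex \<Rightarrow> 'a set \<Rightarrow> complex) \<Rightarrow> complex \<Rightarrow> 'a \<Rightarrow> complex"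
where
  "up D Q H G \<tau> = (\<lambda>\<delta>. \<Sum>\<gamma>\<in>orth D Q H. G \<tau> (H #>\<^bsub>D\<^esub> \<gamma>) * basis_vec \<gamma> \<delta>)"

definition oldform ::
  "int \<Rightarrow> ('a, 'b) monoid_scheme \<Rightarrow> ('a \<Rightarrow> qz) \<Rightarrow> nat \<Rightarrow> (nat \<Rightarrow> 'a set) \<Rightarrow> (complex \<Rightarrow> 'a \<Rightarrow> complex) \<Rightarrow> bool"
where
  "oldform k D Q n H F \<longleftrightarrow>
     (\<exists>G. (\<forall>i\<in>{1..n}. G i \<in> modular_forms k (quot_group D Q (H i)) (quot_form Q)) \<and>
          (\<forall>\<tau>\<in>upper_half_plane. F \<tau> = (\<lambda>\<gamma>. \<Sum>i=1..n. up D Q (H i) (G i) \<tau> \<gamma>)))"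

definition ker_down ::
  "('a, 'b) monoid_scheme \<Rightarrow> ('a \<Rightarrow> qz) \<Rightarrow> nat \<Rightarrow> (nat \<Rightarrow> 'a set) \<Rightarrow> ('a \<Rightarrow> complex) set" where
  "ker_down D Q n H = {v \<in> group_alg D. \<forall>i\<in>{1..n}. down D Q (H i) v = (\<lambda>_. 0)}"

definition form_map ::
  "('a, 'b) monoid_scheme \<Rightarrow> (complex \<Rightarrow> 'a \<Rightarrow> complex) \<Rightarrow> ('a \<Rightarrow> complex) \<Rightarrow> complex \<Rightarrow> complex" where
  "form_map D F v = (\<lambda>\<tau>. \<Sum>\<gamma>\<in>carrier D. v \<gamma> * F \<tau> \<gamma>)"

definition ker_form_map ::
  "('a, 'b) monoid_scheme \<Rightarrow> (complex \<Rightarrow> 'a \<Rightarrow> complex) \<Rightarrow> ('a \<Rightarrow> complex) set" where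
  "ker_form_map D F = {v \<in> group_alg D. \<forall>\<tau>\<in>upper_half_plane. form_map D F v \<tau> = 0}"

end

theory Submission
  imports Defs "HOL-Library.Function_Algebras"
begin

text \<open>The map \<open>\<up>\<close> is the transpose of the real map \<open>\<down>\<close>, so oldforms are orthogonal to
  \<open>ker \<down>\<close>. Conversely, let \<open>A = \<Sum>\<^sub>i \<up>\<^sub>i \<down>\<^sub>i\<close>, the Gram operator of \<open>\<down>\<close>. It is self-adjoint with
  kernel \<open>ker \<down>\<close>, so \<open>A B\<close> fixes every vector orthogonal to \<open>ker \<down>\<close>, where \<open>B\<close> inverts \<open>A\<close>
  on its range and vanishes on its kernel. Since \<open>A\<close> commutes with \<open>\<rho>(S)\<close> and \<open>\<rho>(T)\<close>, hence
  with the Weil representation, so does \<open>B\<close>. Therefore the forms \<open>G\<^sub>i = \<down>\<^sub>i B F\<close> are modular, and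
  \<open>\<Sum>\<^sub>i \<up>\<^sub>i G\<^sub>i = A B F = F\<close>.\<close>

section \<open>Generation of the modular group\<close>

abbreviation mat2 :: "int \<Rightarrow> int \<Rightarrow> int \<Rightarrow> int \<Rightarrow> int ^ 2 ^ 2" where
  "mat2 a b c d \<equiv> vector [vector [a, b], vector [c, d]]"

inductive_set ST_monoid :: "(int ^ 2 ^ 2) set" where
  one: "mat 1 \<in> ST_monoid"
| matS: "M \<in> ST_monoid \<Longrightarrow> matS ** M \<in> ST_monoid"
| matT: "M \<in> ST_monoid \<Longrightarrow> matT ** M \<in> ST_monoid"

lemma matS_in_SL2Z: "matS \<in> SL2Z" and matT_in_SL2Z: "matT \<in> SL2Z"
  by (simp_all add: SL2Z_def matS_def matT_def det_2)

lemma mat_1_in_SL2Z: "mat 1 \<in> SL2Z"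
  by (simp add: SL2Z_def)

lemma mult_in_SL2Z: "M \<in> SL2Z \<Longrightarrow> N \<in> SL2Z \<Longrightarrow> M ** N \<in> SL2Z"
  by (simp add: SL2Z_def det_mul)

lemma ST_monoid_imp_SL2Z: "M \<in> ST_monoid \<Longrightarrow> M \<in> SL2Z"
  by (induction rule: ST_monoid.induct)
    (simp_all add: mat_1_in_SL2Z mult_in_SL2Z matS_in_SL2Z matT_in_SL2Z)

lemma ST_monoid_mat2_one: "mat2 1 0 0 1 \<in> ST_monoid"
proof -
  have "mat2 1 0 0 1 = mat 1"
    by (simp add: vec_eq_iff forall_2 mat_def)
  then show ?thesis using ST_monoid.one by simp
qed

lemma ST_monoid_mat2_matS:
  assumes "mat2 a b c d \<in> ST_monoid"
  shows "mat2 (- c) (- d) a b \<in> ST_monoid"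
proof -
  have "matS ** mat2 a b c d = mat2 (- c) (- d) a b"
    by (simp add: vec_eq_iff forall_2 matS_def matrix_matrix_mult_def sum_2)
  then show ?thesis using ST_monoid.matS[OF assms] by simp
qed

lemma ST_monoid_mat2_matT:
  assumes "mat2 a b c d \<in> ST_monoid"
  shows "mat2 (a + c) (b + d) c d \<in> ST_monoid"
proof -
  have "matT ** mat2 a b c d = mat2 (a + c) (b + d) c d"
    by (simp add: vec_eq_iff forall_2 matT_def matrix_matrix_mult_def sum_2)
  then show ?thesis using ST_monoid.matT[OF assms] by simp
qed

lemma ST_monoid_mat2_minus:
  "mat2 a b c d \<in> ST_monoid \<Longrightarrow> mat2 (- a) (- b) (- c) (- d) \<in> ST_monoid"
  using ST_monoid_mat2_matS ST_monoid_mat2_matS by blast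

lemma ST_monoid_mat2_matS_inverse:
  "mat2 a b c d \<in> ST_monoid \<Longrightarrow> mat2 c d (- a) (- b) \<in> ST_monoid"
  using ST_monoid_mat2_matS[OF ST_monoid_mat2_minus] by simp

lemma ST_monoid_mat2_matT_inverse:
  assumes "mat2 a b c d \<in> ST_monoid"
  shows "mat2 (a - c) (b - d) c d \<in> ST_monoid"
proof -
  \<comment> \<open>\<open>T\<^sup>-\<^sup>1 = S\<^sup>-\<^sup>1 T S T S\<close>\<close>
  have "mat2 (- c) (- d) (a - c) (b - d) \<in> ST_monoid"
    using ST_monoid_mat2_matT[OF ST_monoid_mat2_matS[OF
        ST_monoid_mat2_matT[OF ST_monoid_mat2_matS[OF assms]]]] by simp
  from ST_monoid_mat2_matS_inverse[OF this] show ?thesis by (simp add: algebra_simps)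
qed

lemma ST_monoid_mat2_matT_power:
  assumes "mat2 a b c d \<in> ST_monoid"
  shows "mat2 (a + q * c) (b + q * d) c d \<in> ST_monoid"
proof (induction q rule: int_induct[of _ 0])
  case base
  show ?case using assms by simp
next
  case (step1 q)
  then show ?case using ST_monoid_mat2_matT by (force simp: algebra_simps)
next
  case (step2 q)
  then show ?case using ST_monoid_mat2_matT_inverse by (force simp: algebra_simps)
qed

lemma ST_monoid_upper_triangular:
  fixes a b d :: int
  assumes "a * d = 1"
  shows "mat2 a b 0 d \<in> ST_monoid"
proof -
  from assms consider "a = 1" "d = 1" | "a = - 1" "d = - 1"
    using zmult_eq_1_iff by blast
  then show ?thesis
  proof cases
    assume "a = 1" "d = 1"
    then show ?thesis using ST_monoid_mat2_matT_power[OF ST_monoid_mat2_one, of b] by simp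
  next
    assume "a = - 1" "d = - 1"
    then show ?thesis
      using ST_monoid_mat2_minus[OF ST_monoid_mat2_matT_power[OF ST_monoid_mat2_one, of "- b"]]
      by simp
  qed
qed

lemma det_1_imp_ST_monoid:
  fixes a b c d :: int
  assumes "a * d - b * c = 1"
  shows "mat2 a b c d \<in> ST_monoid"
  using assms
proof (induction "nat \<bar>c\<bar>" arbitrary: a b c d rule: less_induct)
  case less
  show ?case
  proof (cases "c = 0")
    case True
    then show ?thesis using less.prems ST_monoid_upper_triangular by simp
  next
    case False
    define q where "q = a div c"
    have "mat2 (- c) (- d) (a mod c) (b - q * d) \<in> ST_monoid"
    proof (rule less.hyps)
      show "nat \<bar>a mod c\<bar> < nat \<bar>c\<bar>"
        using False by (simp add: abs_mod_less)
      show "(- c) * (b - q * d) - (- d) * (a mod c) = 1"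
        using less.prems by (simp add: q_def algebra_simps minus_div_mult_eq_mod[symmetric])
    qed
    then have "mat2 (a mod c) (b - q * d) c d \<in> ST_monoid"
      using ST_monoid_mat2_matS_inverse by force
    from ST_monoid_mat2_matT_power[OF this, of q] show ?thesis
      by (simp add: q_def)
  qed
qed

theorem SL2Z_eq_ST_monoid: "SL2Z = ST_monoid"
proof (intro equalityI subsetI)
  fix M :: "int ^ 2 ^ 2"
  assume "M \<in> SL2Z"
  then have "mat2 (M $ 1 $ 1) (M $ 1 $ 2) (M $ 2 $ 1) (M $ 2 $ 2) \<in> ST_monoid"
    by (intro det_1_imp_ST_monoid) (simp add: SL2Z_def det_2)
  moreover have "mat2 (M $ 1 $ 1) (M $ 1 $ 2) (M $ 2 $ 1) (M $ 2 $ 2) = M"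
    by (simp add: vec_eq_iff forall_2)
  ultimately show "M \<in> ST_monoid" by simp
qed (rule ST_monoid_imp_SL2Z)

section \<open>Group inverses of operators of index one\<close>

lemma (in vector_space) linear_inj_on_imp_surj_on_subspace:
  assumes f: "Vector_Spaces.linear scale scale f"
    and T: "subspace T" "f ` T \<subseteq> T" and inj: "inj_on f T"
    and B: "finite B" "T \<subseteq> span B"
  shows "f ` T = T"
proof -
  interpret f: Vector_Spaces.linear scale scale f by (rule f)
  obtain C where C: "C \<subseteq> T" "independent C" "T \<subseteq> span C"
    by (rule maximal_independent_subset)
  have span_C: "span C = T"
    using C T(1) by (intro span_subspace)
  have fin_C: "finite C"
    using independent_span_bound[OF B(1) C(2)] C(1) B(2) by blast
  have indep: "independent (f ` C)"
    using inj by (intro f.independent_injective_image C(2)) (simp add: span_C)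
  have card: "card (f ` C) = card C"
    using inj C(1) by (intro card_image) (rule inj_on_subset)
  have "y \<in> span (f ` C)" if y: "y \<in> T" for y
  proof (rule ccontr)
    assume new: "y \<notin> span (f ` C)"
    have "card (insert y (f ` C)) \<le> card C"
      using independent_span_bound[OF fin_C independent_insertI[OF new indep]] y C(1) T(2)
      by (auto simp: span_C)
    moreover have "card (insert y (f ` C)) = Suc (card C)"
      using new span_base fin_C card by (subst card_insert_disjoint) auto
    ultimately show False by simp
  qed
  then show ?thesis
    using T(2) f.span_image[of C] by (auto simp: span_C)
qed

text \<open>If \<open>range f\<close> and \<open>ker f\<close> are complementary, this operator inverts \<open>f\<close> on \<open>range f\<close> and
  annihilates \<open>ker f\<close>.\<close>

definition group_inverse :: "('v \<Rightarrow> 'v) \<Rightarrow> 'v \<Rightarrow> 'v" where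
  "group_inverse f y = (THE x. x \<in> range f \<and> f (f x) = f y)"

locale index_one_operator = Vector_Spaces.linear scale scale f
  for scale :: "'k::field \<Rightarrow> 'v::ab_group_add \<Rightarrow> 'v" and f +
  assumes finite_rank: "\<exists>B. finite B \<and> range f \<subseteq> vs1.span B"
    and kernel_square: "f (f x) = 0 \<Longrightarrow> f x = 0"
begin

lemma inj_on_range: "inj_on f (range f)"
proof (rule inj_onI)
  fix u v assume "u \<in> range f" "v \<in> range f" and "f u = f v"
  then obtain x y where "u = f x" "v = f y" by blast
  with \<open>f u = f v\<close> have "f (f (x - y)) = 0" by (simp add: diff)
  then have "f (x - y) = 0" by (rule kernel_square)
  then show "u = v" by (simp add: \<open>u = f x\<close> \<open>v = f y\<close> diff)
qed

lemma image_range: "f ` range f = range f"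
proof -
  obtain B where "finite B" "range f \<subseteq> vs1.span B"
    using finite_rank by blast
  moreover have "vs1.subspace (range f)"
    using subspace_image[OF vs1.subspace_UNIV] .
  ultimately show ?thesis
    using inj_on_range by (intro vs1.linear_inj_on_imp_surj_on_subspace linear_axioms) auto
qed

lemma ex1_group_inverse: "\<exists>!x. x \<in> range f \<and> f (f x) = f y"
proof (rule ex_ex1I)
  have "f y \<in> f ` f ` range f" by (simp add: image_range)
  then show "\<exists>x. x \<in> range f \<and> f (f x) = f y" by (auto simp: image_iff)
next
  fix u v
  assume "u \<in> range f \<and> f (f u) = f y" "v \<in> range f \<and> f (f v) = f y"
  then have "u \<in> range f" "v \<in> range f" "f (f u) = f (f v)" by simp_all
  then show "u = v" using inj_on_range by (simp add: inj_on_eq_iff)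
qed

lemma group_inverse_in_range: "group_inverse f y \<in> range f"
  and f_f_group_inverse: "f (f (group_inverse f y)) = f y"
  using theI'[OF ex1_group_inverse[of y]] by (simp_all add: group_inverse_def)

lemma group_inverse_eqI: "x \<in> range f \<Longrightarrow> f (f x) = f y \<Longrightarrow> group_inverse f y = x"
  using ex1_group_inverse group_inverse_in_range f_f_group_inverse by blast

lemma linear_group_inverse: "Vector_Spaces.linear scale scale (group_inverse f)"
proof -
  have range: "vs1.subspace (range f)"
    using subspace_image[OF vs1.subspace_UNIV] .
  have "group_inverse f (x + y) = group_inverse f x + group_inverse f y" for x y
    by (rule group_inverse_eqI)
      (simp_all add: vs1.subspace_add[OF range] group_inverse_in_range f_f_group_inverse add)
  moreover have "group_inverse f (scale c x) = scale c (group_inverse f x)" for c x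
    by (rule group_inverse_eqI)
      (simp_all add: vs1.subspace_scale[OF range] group_inverse_in_range f_f_group_inverse scale)
  ultimately show ?thesis
    using vs1.vector_space_axioms by (simp add: Vector_Spaces.linear_iff)
qed

lemma group_inverse_commute:
  assumes V: "range f \<subseteq> V" "L ` V \<subseteq> V"
    and comm: "\<And>x. x \<in> V \<Longrightarrow> L (f x) = f (L x)"
    and y: "y \<in> V"
  shows "group_inverse f (L y) = L (group_inverse f y)"
proof (rule group_inverse_eqI)
  have "group_inverse f y \<in> f ` range f"
    using group_inverse_in_range by (simp add: image_range)
  then show "L (group_inverse f y) \<in> range f"
    using comm V(1) by auto
  have "f (f (L (group_inverse f y))) = L (f (f (group_inverse f y)))"
    using comm V group_inverse_in_range by (metis range_subsetD subsetD)
  then show "f (f (L (group_inverse f y))) = f (L y)"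
    using comm y by (simp add: f_f_group_inverse)
qed

end

section \<open>Group algebras\<close>

lemma sum_mult_basis_vec:
  assumes "finite A"
  shows "(\<Sum>\<beta>\<in>A. f \<beta> * basis_vec \<beta> \<delta>) = (if \<delta> \<in> A then f \<delta> else 0)"
proof -
  have "(\<Sum>\<beta>\<in>A. f \<beta> * basis_vec \<beta> \<delta>) = (\<Sum>\<beta>\<in>A. if \<delta> = \<beta> then f \<beta> else 0)"
    by (intro sum.cong) (auto simp: basis_vec_def)
  then show ?thesis using assms by simp
qed

lemma group_alg_basis_vec: "\<gamma> \<in> carrier D \<Longrightarrow> basis_vec \<gamma> \<in> group_alg D"
  by (auto simp: group_alg_def basis_vec_def)

lemma group_alg_expand:
  assumes "finite (carrier D)" "v \<in> group_alg D"
  shows "v = (\<lambda>\<delta>. \<Sum>\<gamma>\<in>carrier D. v \<gamma> * basis_vec \<gamma> \<delta>)"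
  using assms by (auto simp: sum_mult_basis_vec group_alg_def)

lemma group_alg_scale: "v \<in> group_alg D \<Longrightarrow> (\<lambda>\<gamma>. a * v \<gamma>) \<in> group_alg D"
  by (simp add: group_alg_def)

lemma group_alg_sum:
  "(\<And>j. j \<in> J \<Longrightarrow> v j \<in> group_alg D) \<Longrightarrow> (\<lambda>\<gamma>. \<Sum>j\<in>J. a j * v j \<gamma>) \<in> group_alg D"
  by (simp add: group_alg_def)

lemma group_alg_cnj: "v \<in> group_alg D \<Longrightarrow> (\<lambda>\<gamma>. cnj (v \<gamma>)) \<in> group_alg D"
  by (simp add: group_alg_def)

definition group_alg_linear ::
  "('a, 'b) monoid_scheme \<Rightarrow> ('c, 'd) monoid_scheme \<Rightarrow> (('a \<Rightarrow> complex) \<Rightarrow> 'c \<Rightarrow> complex) \<Rightarrow> bool"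
where
  "group_alg_linear D E L \<longleftrightarrow>
     (\<forall>v\<in>group_alg D. L v \<in> group_alg E) \<and>
     (\<forall>v\<in>group_alg D. \<forall>w\<in>group_alg D. \<forall>a b.
        L (\<lambda>\<gamma>. a * v \<gamma> + b * w \<gamma>) = (\<lambda>\<gamma>. a * L v \<gamma> + b * L w \<gamma>))"

lemma group_alg_linear_mem: "group_alg_linear D E L \<Longrightarrow> v \<in> group_alg D \<Longrightarrow> L v \<in> group_alg E"
  by (simp add: group_alg_linear_def)

lemma group_alg_linear_combination:
  "group_alg_linear D E L \<Longrightarrow> v \<in> group_alg D \<Longrightarrow> w \<in> group_alg D \<Longrightarrow>
   L (\<lambda>\<gamma>. a * v \<gamma> + b * w \<gamma>) = (\<lambda>\<gamma>. a * L v \<gamma> + b * L w \<gamma>)"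
  by (simp add: group_alg_linear_def)

lemma group_alg_linear_scale:
  "group_alg_linear D E L \<Longrightarrow> v \<in> group_alg D \<Longrightarrow> L (\<lambda>\<gamma>. a * v \<gamma>) = (\<lambda>\<gamma>. a * L v \<gamma>)"
  using group_alg_linear_combination[of D E L v v a 0] by simp

lemma group_alg_linear_sum:
  assumes L: "group_alg_linear D E L" and "finite J" and "\<And>j. j \<in> J \<Longrightarrow> v j \<in> group_alg D"
  shows "L (\<lambda>\<gamma>. \<Sum>j\<in>J. a j * v j \<gamma>) = (\<lambda>\<gamma>. \<Sum>j\<in>J. a j * L (v j) \<gamma>)"
  using assms(2,3)
proof (induction J rule: finite_induct)
  case empty
  then show ?case
    using group_alg_linear_scale[OF L, of "\<lambda>_. 0" 0] by (simp add: group_alg_def)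
next
  case (insert i J)
  have "L (\<lambda>\<gamma>. a i * v i \<gamma> + 1 * (\<Sum>j\<in>J. a j * v j \<gamma>)) =
        (\<lambda>\<gamma>. a i * L (v i) \<gamma> + 1 * L (\<lambda>\<gamma>. \<Sum>j\<in>J. a j * v j \<gamma>) \<gamma>)"
    using insert.prems by (intro group_alg_linear_combination[OF L] group_alg_sum) auto
  then show ?case using insert by simp
qed

lemma group_alg_linear_expand:
  assumes "group_alg_linear D E L" "finite (carrier D)" "v \<in> group_alg D"
  shows "L v = (\<lambda>\<delta>. \<Sum>\<gamma>\<in>carrier D. v \<gamma> * L (basis_vec \<gamma>) \<delta>)"
  using group_alg_linear_sum[OF assms(1,2), of basis_vec v] group_alg_expand[OF assms(2,3)]
  by (simp add: group_alg_basis_vec)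

lemma group_alg_linear_compose:
  "group_alg_linear D E L \<Longrightarrow> group_alg_linear E E' L' \<Longrightarrow> group_alg_linear D E' (\<lambda>v. L' (L v))"
  by (simp add: group_alg_linear_def)

definition fun_scale :: "complex \<Rightarrow> ('a \<Rightarrow> complex) \<Rightarrow> 'a \<Rightarrow> complex" where
  "fun_scale c v = (\<lambda>\<gamma>. c * v \<gamma>)"

lemma fun_scale_apply [simp]: "fun_scale c v \<gamma> = c * v \<gamma>"
  by (simp add: fun_scale_def)

interpretation fun_space: vector_space "fun_scale :: complex \<Rightarrow> ('a \<Rightarrow> complex) \<Rightarrow> 'a \<Rightarrow> complex"
  by unfold_locales (simp_all add: fun_eq_iff algebra_simps)

abbreviation fun_linear :: "(('a \<Rightarrow> complex) \<Rightarrow> 'c \<Rightarrow> complex) \<Rightarrow> bool" where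
  "fun_linear \<equiv> Vector_Spaces.linear fun_scale fun_scale"

lemma fun_linearI:
  assumes "\<And>v w. L (v + w) = L v + L w" "\<And>c v. L (fun_scale c v) = fun_scale c (L v)"
  shows "fun_linear L"
  unfolding Vector_Spaces.linear_iff
  by (intro conjI allI fun_space.vector_space_axioms assms)

lemma group_alg_linear_if_fun_linear:
  assumes L: "fun_linear L" and "\<And>v. v \<in> group_alg D \<Longrightarrow> L v \<in> group_alg E"
  shows "group_alg_linear D E L"
proof -
  have "L (\<lambda>\<gamma>. a * v \<gamma> + b * w \<gamma>) = (\<lambda>\<gamma>. a * L v \<gamma> + b * L w \<gamma>)" for a b v w
  proof -
    have "L (fun_scale a v + fun_scale b w) = fun_scale a (L v) + fun_scale b (L w)"
      using L by (simp add: Vector_Spaces.linear_iff)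
    then show ?thesis by (simp add: fun_scale_def plus_fun_def)
  qed
  then show ?thesis using assms(2) by (simp add: group_alg_linear_def)
qed

lemma sum_fun_apply: "(\<Sum>a\<in>A. f a) x = (\<Sum>a\<in>A. f a x)"
  by (induction A rule: infinite_finite_induct) simp_all

lemma group_alg_subset_span:
  assumes "finite (carrier D)"
  shows "group_alg D \<subseteq> fun_space.span (basis_vec ` carrier D)"
proof
  fix v :: "'a \<Rightarrow> complex"
  assume "v \<in> group_alg D"
  then have "v = (\<Sum>\<gamma>\<in>carrier D. fun_scale (v \<gamma>) (basis_vec \<gamma>))"
    using group_alg_expand[OF assms] by (simp add: fun_eq_iff sum_fun_apply)
  also have "\<dots> \<in> fun_space.span (basis_vec ` carrier D)"
    by (intro fun_space.span_sum fun_space.span_scale fun_space.span_base imageI)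
  finally show "v \<in> fun_space.span (basis_vec ` carrier D)" .
qed

definition hermitian_form ::
  "('a, 'b) monoid_scheme \<Rightarrow> ('a \<Rightarrow> complex) \<Rightarrow> ('a \<Rightarrow> complex) \<Rightarrow> complex"
where
  "hermitian_form D x y = (\<Sum>\<gamma>\<in>carrier D. cnj (x \<gamma>) * y \<gamma>)"

lemma cnj_hermitian_form: "cnj (hermitian_form D x y) = hermitian_form D y x"
  by (simp add: hermitian_form_def mult.commute)

lemma hermitian_form_diff_right:
  "hermitian_form D x (y - z) = hermitian_form D x y - hermitian_form D x z"
  by (simp add: hermitian_form_def right_diff_distrib sum_subtractf)

lemma hermitian_form_sum_right:
  "hermitian_form D x (\<lambda>\<gamma>. \<Sum>j\<in>J. y j \<gamma>) = (\<Sum>j\<in>J. hermitian_form D x (y j))"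
  unfolding hermitian_form_def sum_distrib_left by (rule sum.swap)

lemma hermitian_form_self:
  "hermitian_form D x x = of_real (\<Sum>\<gamma>\<in>carrier D. (norm (x \<gamma>))\<^sup>2)"
  by (simp add: hermitian_form_def complex_norm_square[symmetric] mult.commute)

lemma hermitian_form_self_eq_0_iff:
  assumes "finite (carrier D)" "x \<in> group_alg D"
  shows "hermitian_form D x x = 0 \<longleftrightarrow> x = (\<lambda>_. 0)"
proof -
  have "hermitian_form D x x = 0 \<longleftrightarrow> (\<forall>\<gamma>\<in>carrier D. x \<gamma> = 0)"
    unfolding hermitian_form_self of_real_eq_0_iff
    using assms(1) by (simp add: sum_nonneg_eq_0_iff)
  then show ?thesis using assms(2) by (auto simp: group_alg_def)
qed

section \<open>Discriminant forms\<close>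

lemma qz_ee_zero: "qz_ee 0 = 1"
  by transfer (simp add: ee_def)

lemma qz_ee_add: "qz_ee (x + y) = qz_ee x * qz_ee y"
  by transfer (simp add: ee_def of_rat_add distrib_left exp_add)

lemma of_real_of_rat: "complex_of_real (of_rat x) = of_rat x"
  by (cases x) (simp add: Fract_of_int_quotient of_rat_divide)

lemma qz_ee_minus: "qz_ee (- x) = cnj (qz_ee x)"
  by transfer (simp add: ee_def exp_cnj of_rat_minus flip: of_real_of_rat)

lemma qz_ee_eq_1_iff: "qz_ee x = 1 \<longleftrightarrow> x = 0"
proof transfer
  fix x :: rat
  have "ee (of_rat x) = 1 \<longleftrightarrow> (\<exists>n::int. of_rat x = (of_int n :: real))"
    by (simp add: ee_def exp_eq_1 flip: of_real_of_rat)
  also have "\<dots> \<longleftrightarrow> (\<exists>n::int. x = of_int n)"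
    by (metis of_rat_eq_iff of_rat_of_int_eq)
  finally show "ee (of_rat x) = 1 \<longleftrightarrow> qz_rel x 0"
    by (auto simp: qz_rel_def elim: Ints_cases)
qed

lemma (in group) sum_subgroup_translate:
  assumes K: "subgroup K G" and k: "k \<in> K"
  shows "(\<Sum>x\<in>K. f (k \<otimes> x)) = (\<Sum>x\<in>K. f x)"
proof -
  have "(\<lambda>x. k \<otimes> x) ` K = K"
    using group.surj_const_mult[OF subgroup_imp_group[OF K]] k by simp
  moreover have "inj_on (\<lambda>x. k \<otimes> x) K"
    using inj_on_cmult subgroup.subset[OF K] k by (blast intro: inj_on_subset)
  ultimately show ?thesis
    using sum.reindex[of "\<lambda>x. k \<otimes> x" K f] by simp
qed

locale disc_form =
  fixes D :: "('a, 'b) monoid_scheme" (structure) and Q :: "'a \<Rightarrow> qz"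
  assumes disc: "discriminant_form D Q"
begin

sublocale comm_group D
  using disc by (simp add: discriminant_form_def)

lemma finite_carrier: "finite (carrier D)"
  using disc by (simp add: discriminant_form_def)

lemma bil_mult_left:
  "x \<in> carrier D \<Longrightarrow> y \<in> carrier D \<Longrightarrow> z \<in> carrier D \<Longrightarrow>
   bil D Q (x \<otimes> y) z = bil D Q x z + bil D Q y z"
  using disc by (simp add: discriminant_form_def)

lemma bil_mult_right:
  "x \<in> carrier D \<Longrightarrow> y \<in> carrier D \<Longrightarrow> z \<in> carrier D \<Longrightarrow>
   bil D Q x (y \<otimes> z) = bil D Q x y + bil D Q x z"
  using disc by (simp add: discriminant_form_def)

lemma bil_commute: "x \<in> carrier D \<Longrightarrow> y \<in> carrier D \<Longrightarrow> bil D Q x y = bil D Q y x"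
  by (simp add: bil_def m_comm)

lemma bil_one_left: "x \<in> carrier D \<Longrightarrow> bil D Q \<one> x = 0"
  using bil_mult_left[of \<one> \<one> x] by simp

lemma bil_inv_left:
  assumes "x \<in> carrier D" "y \<in> carrier D"
  shows "bil D Q (inv x) y = - bil D Q x y"
  using bil_mult_left[of "inv x" x y] assms
  by (simp add: bil_one_left eq_neg_iff_add_eq_0)

lemma bil_eq_0_iff: "x \<in> carrier D \<Longrightarrow> (\<forall>y\<in>carrier D. bil D Q x y = 0) \<longleftrightarrow> x = \<one>"
  using disc bil_one_left by (auto simp: discriminant_form_def)

lemma character_sum:
  assumes K: "subgroup K D" and g: "g \<in> carrier D"
  shows "(\<Sum>x\<in>K. qz_ee (bil D Q g x)) = (if \<forall>x\<in>K. bil D Q g x = 0 then of_nat (card K) else 0)"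
proof (cases "\<forall>x\<in>K. bil D Q g x = 0")
  case True
  then show ?thesis by (simp add: qz_ee_zero)
next
  case False
  then obtain k where k: "k \<in> K" "bil D Q g k \<noteq> 0" by blast
  have "(\<Sum>x\<in>K. qz_ee (bil D Q g x)) = (\<Sum>x\<in>K. qz_ee (bil D Q g (k \<otimes> x)))"
    by (rule sum_subgroup_translate[OF K k(1), symmetric])
  also have "\<dots> = qz_ee (bil D Q g k) * (\<Sum>x\<in>K. qz_ee (bil D Q g x))"
    using k(1) subgroup.mem_carrier[OF K] g by (simp add: bil_mult_right qz_ee_add sum_distrib_left)
  finally have "(\<Sum>x\<in>K. qz_ee (bil D Q g x)) = 0"
    using k(2) qz_ee_eq_1_iff by simp
  then show ?thesis by (simp only: if_not_P[OF False])
qed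

lemma character_sum_carrier:
  "g \<in> carrier D \<Longrightarrow>
   (\<Sum>x\<in>carrier D. qz_ee (bil D Q g x)) = (if g = \<one> then of_nat (card (carrier D)) else 0)"
  using character_sum[OF subgroup_self] by (simp add: bil_eq_0_iff)

end

section \<open>Isotropic subgroups and their quotients\<close>

locale isotropic = disc_form +
  fixes H
  assumes iso: "isotropic_subgroup D Q H"
begin

abbreviation perp where "perp \<equiv> orth D Q H"

abbreviation quot where "quot \<equiv> quot_group D Q H"

lemma subgroup_H: "subgroup H D" and Q_H: "h \<in> H \<Longrightarrow> Q h = 0"
  using iso by (simp_all add: isotropic_subgroup_def)

lemma H_carrier: "h \<in> H \<Longrightarrow> h \<in> carrier D"
  using subgroup.mem_carrier[OF subgroup_H] .

lemma finite_H: "finite H"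
  using finite_carrier H_carrier by (meson finite_subset subsetI)

lemma card_H_pos: "card H > 0"
  using finite_H subgroup.one_closed[OF subgroup_H] card_gt_0_iff by blast

lemma perp_carrier: "x \<in> perp \<Longrightarrow> x \<in> carrier D"
  by (simp add: orth_def)

lemma finite_perp: "finite perp"
  using finite_carrier by (simp add: orth_def)

lemma bil_perp_H: "x \<in> perp \<Longrightarrow> h \<in> H \<Longrightarrow> bil D Q x h = 0"
  by (simp add: orth_def)

lemma H_perp: "h \<in> H \<Longrightarrow> h \<in> perp"
  using subgroup.m_closed[OF subgroup_H] H_carrier Q_H by (simp add: orth_def bil_def)

lemma subgroup_perp: "subgroup perp D"
proof
  show "perp \<subseteq> carrier D" using perp_carrier by auto
  show "\<one> \<in> perp" using H_perp subgroup.one_closed[OF subgroup_H] by simp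
  show "x \<otimes> y \<in> perp" if "x \<in> perp" "y \<in> perp" for x y
    using that H_carrier by (simp add: orth_def bil_mult_left)
  show "inv x \<in> perp" if "x \<in> perp" for x
    using that H_carrier by (simp add: orth_def bil_inv_left)
qed

lemma H_mult_perp: "h \<in> H \<Longrightarrow> x \<in> perp \<Longrightarrow> h \<otimes> x \<in> perp"
  using subgroup.m_closed[OF subgroup_perp] H_perp by blast

lemma Q_H_mult: "h \<in> H \<Longrightarrow> x \<in> carrier D \<Longrightarrow> Q (h \<otimes> x) = Q x + bil D Q x h"
  using bil_commute[of x h] Q_H H_carrier by (simp add: bil_def)

lemma Q_H_mult_perp: "h \<in> H \<Longrightarrow> x \<in> perp \<Longrightarrow> Q (h \<otimes> x) = Q x"
  by (simp add: Q_H_mult perp_carrier bil_perp_H)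

lemma coset_eq_image: "H #> x = (\<lambda>h. h \<otimes> x) ` H"
  by (auto simp: r_coset_def)

lemma sum_coset: "x \<in> carrier D \<Longrightarrow> sum f (H #> x) = (\<Sum>h\<in>H. f (h \<otimes> x))"
  using inj_on_subset[OF inj_on_multc subgroup.subset[OF subgroup_H]]
  by (simp add: coset_eq_image sum.reindex)

lemma coset_perp: "x \<in> perp \<Longrightarrow> y \<in> H #> x \<Longrightarrow> y \<in> perp"
  using H_mult_perp by (auto simp: coset_eq_image)

lemma coset_eq_iff: "x \<in> carrier D \<Longrightarrow> y \<in> carrier D \<Longrightarrow> H #> x = H #> y \<longleftrightarrow> x \<in> H #> y"
  using repr_independence[OF _ _ subgroup_H] rcos_self[OF _ subgroup_H] by metis

lemma coset_H_mult: "h \<in> H \<Longrightarrow> x \<in> carrier D \<Longrightarrow> H #> (h \<otimes> x) = H #> x"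
  using coset_eq_iff[of "h \<otimes> x" x] H_carrier by (auto simp: coset_eq_image)

lemma coset_fibre: "x \<in> perp \<Longrightarrow> {y \<in> perp. H #> y = H #> x} = H #> x"
  using coset_eq_iff perp_carrier coset_perp by blast

lemma carrier_quot: "carrier quot = (\<lambda>x. H #> x) ` perp"
  by (auto simp: quot_group_def FactGroup_def RCOSETS_def r_coset_def)

lemma finite_quot: "finite (carrier quot)"
  using finite_perp by (simp add: carrier_quot)

lemma mult_quot:
  assumes "x \<in> perp" "y \<in> perp"
  shows "(H #> x) \<otimes>\<^bsub>quot\<^esub> (H #> y) = H #> (x \<otimes> y)"
proof -
  have "(H #> x) <#> (H #> y) = H #> (x \<otimes> y)"
    using normal.rcos_sum[OF subgroup_imp_normal[OF subgroup_H]] assms perp_carrier by simp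
  then show ?thesis
    by (simp add: quot_group_def FactGroup_def set_mult_def)
qed

lemma sum_perp_fibres: "(\<Sum>x\<in>perp. f x) = (\<Sum>\<alpha>\<in>carrier quot. \<Sum>x\<in>{y \<in> perp. H #> y = \<alpha>}. f x)"
  unfolding carrier_quot by (rule sum.image_gen[OF finite_perp])

lemma sum_perp_H_invariant:
  fixes f :: "'a \<Rightarrow> 'c::semiring_1"
  assumes "\<And>x h. x \<in> perp \<Longrightarrow> h \<in> H \<Longrightarrow> f (h \<otimes> x) = g (H #> x)"
  shows "(\<Sum>x\<in>perp. f x) = of_nat (card H) * (\<Sum>\<alpha>\<in>carrier quot. g \<alpha>)"
  unfolding sum_perp_fibres sum_distrib_left
  using assms by (intro sum.cong) (auto simp: carrier_quot coset_fibre sum_coset perp_carrier)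

lemma quot_form_coset:
  assumes "x \<in> perp"
  shows "quot_form Q (H #> x) = Q x"
proof -
  have "Q ` (H #> x) = {Q x}"
    using assms Q_H_mult_perp subgroup.one_closed[OF subgroup_H]
    by (auto simp: coset_eq_image image_iff)
  then show ?thesis by (simp add: quot_form_def)
qed

lemma bil_quot:
  "x \<in> perp \<Longrightarrow> y \<in> perp \<Longrightarrow> bil quot (quot_form Q) (H #> x) (H #> y) = bil D Q x y"
  using subgroup.m_closed[OF subgroup_perp]
  by (simp add: bil_def mult_quot quot_form_coset)

lemma character_sum_H:
  "g \<in> carrier D \<Longrightarrow> (\<Sum>h\<in>H. qz_ee (bil D Q g h)) = (if g \<in> perp then of_nat (card H) else 0)"
  using character_sum[OF subgroup_H] by (simp add: orth_def)

lemma sum_if_perp: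
  "(\<Sum>\<gamma>\<in>carrier D. if \<gamma> \<in> perp then f \<gamma> else 0) = (\<Sum>\<gamma>\<in>perp. f \<gamma>)"
  using finite_carrier perp_carrier by (intro sum.mono_neutral_cong_right) auto

lemma card_H_mult_card_perp: "card H * card perp = card (carrier D)"
proof -
  have "(of_nat (card H * card perp) :: complex) =
      (\<Sum>g\<in>carrier D. if g \<in> perp then of_nat (card H) else 0)"
    by (simp add: sum_if_perp)
  also have "\<dots> = (\<Sum>g\<in>carrier D. \<Sum>h\<in>H. qz_ee (bil D Q g h))"
    by (simp add: character_sum_H)
  also have "\<dots> = (\<Sum>h\<in>H. \<Sum>g\<in>carrier D. qz_ee (bil D Q h g))"
    by (subst sum.swap) (simp add: bil_commute H_carrier)
  also have "\<dots> = (\<Sum>h\<in>H. if h = \<one> then of_nat (card (carrier D)) else 0)"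
    by (simp add: character_sum_carrier H_carrier)
  also have "\<dots> = of_nat (card (carrier D))"
    using finite_H subgroup.one_closed[OF subgroup_H] by simp
  finally show ?thesis by (simp only: of_nat_eq_iff)
qed

lemma card_carrier: "card (carrier D) = (card H)\<^sup>2 * card (carrier quot)"
proof -
  have "card perp = card H * card (carrier quot)"
    using sum_perp_H_invariant[of "\<lambda>_. 1::nat" "\<lambda>_. 1"] by simp
  then show ?thesis
    by (simp add: card_H_mult_card_perp[symmetric] power2_eq_square)
qed

lemma sqrt_card_carrier:
  "sqrt (real (card (carrier D))) = real (card H) * sqrt (real (card (carrier quot)))"
  by (simp add: card_carrier real_sqrt_mult)

text \<open>Translating the Gauss sum by \<open>h \<in> H\<close> twists it by the character \<open>(\<cdot>, h)\<close>; averaging over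
  \<open>H\<close> leaves only the terms in \<open>H\<^sup>\<bottom>\<close>.\<close>

lemma gauss_sum_perp: "(\<Sum>\<gamma>\<in>carrier D. qz_ee (Q \<gamma>)) = (\<Sum>\<gamma>\<in>perp. qz_ee (Q \<gamma>))"
proof -
  have twist: "(\<Sum>\<gamma>\<in>carrier D. qz_ee (Q \<gamma>)) = (\<Sum>\<gamma>\<in>carrier D. qz_ee (Q \<gamma>) * qz_ee (bil D Q \<gamma> h))"
    if h: "h \<in> H" for h
    using sum_subgroup_translate[OF subgroup_self H_carrier[OF h], of "\<lambda>\<gamma>. qz_ee (Q \<gamma>)"] h
    by (simp add: Q_H_mult qz_ee_add)
  have "of_nat (card H) * (\<Sum>\<gamma>\<in>carrier D. qz_ee (Q \<gamma>)) =
      (\<Sum>h\<in>H. \<Sum>\<gamma>\<in>carrier D. qz_ee (Q \<gamma>) * qz_ee (bil D Q \<gamma> h))"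
    by (simp flip: twist)
  also have "\<dots> = (\<Sum>\<gamma>\<in>carrier D. qz_ee (Q \<gamma>) * (\<Sum>h\<in>H. qz_ee (bil D Q \<gamma> h)))"
    by (subst sum.swap) (simp add: sum_distrib_left)
  also have "\<dots> = (\<Sum>\<gamma>\<in>carrier D. if \<gamma> \<in> perp then of_nat (card H) * qz_ee (Q \<gamma>) else 0)"
    by (intro sum.cong) (simp_all add: character_sum_H mult.commute)
  also have "\<dots> = of_nat (card H) * (\<Sum>\<gamma>\<in>perp. qz_ee (Q \<gamma>))"
    by (simp add: sum_if_perp sum_distrib_left)
  finally show ?thesis using card_H_pos by simp
qed

lemma gauss_sum_quot:
  "(\<Sum>\<gamma>\<in>carrier D. qz_ee (Q \<gamma>)) = of_nat (card H) * (\<Sum>\<alpha>\<in>carrier quot. qz_ee (quot_form Q \<alpha>))"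
  unfolding gauss_sum_perp
  by (rule sum_perp_H_invariant) (simp add: Q_H_mult_perp quot_form_coset)

lemma disc_sign_quot: "disc_sign quot (quot_form Q) = disc_sign D Q"
proof -
  have "is_signature quot (quot_form Q) s \<longleftrightarrow> is_signature D Q s" for s
    using card_H_pos by (simp add: is_signature_def gauss_sum_quot sqrt_card_carrier mult.assoc)
  then show ?thesis by (simp add: disc_sign_def)
qed

end

section \<open>Arrow operators\<close>

definition up_vec ::
  "('a, 'b) monoid_scheme \<Rightarrow> ('a \<Rightarrow> qz) \<Rightarrow> 'a set \<Rightarrow> ('a set \<Rightarrow> complex) \<Rightarrow> 'a \<Rightarrow> complex"
where
  "up_vec D Q H w = (\<lambda>\<gamma>. if \<gamma> \<in> orth D Q H then w (H #>\<^bsub>D\<^esub> \<gamma>) else 0)"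

context isotropic
begin

abbreviation down_H where "down_H \<equiv> down D Q H"

abbreviation up_H where "up_H \<equiv> up_vec D Q H"

lemma up_eq_up_vec: "up D Q H G \<tau> = up_H (G \<tau>)"
  by (simp add: up_def up_vec_def sum_mult_basis_vec finite_perp)

lemma down_eq_fibre_sum: "down_H v \<alpha> = (\<Sum>\<gamma>\<in>{\<gamma>\<in>perp. H #> \<gamma> = \<alpha>}. v \<gamma>)"
proof -
  have "down_H v \<alpha> = (\<Sum>\<gamma>\<in>perp. if H #> \<gamma> = \<alpha> then v \<gamma> else 0)"
    unfolding down_def by (intro sum.cong) (auto simp: basis_vec_def)
  then show ?thesis
    using finite_perp by (simp add: sum.inter_filter)
qed

lemma down_coset: "x \<in> perp \<Longrightarrow> down_H v (H #> x) = (\<Sum>h\<in>H. v (h \<otimes> x))"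
  by (simp add: down_eq_fibre_sum coset_fibre sum_coset perp_carrier)

lemma down_basis_vec:
  assumes "x \<in> perp"
  shows "down_H (basis_vec x) = basis_vec (H #> x)"
proof
  fix \<alpha>
  have "down_H (basis_vec x) \<alpha> = (\<Sum>\<gamma>\<in>perp. basis_vec (H #> \<gamma>) \<alpha> * basis_vec \<gamma> x)"
    unfolding down_def by (intro sum.cong) (auto simp: basis_vec_def)
  then show "down_H (basis_vec x) \<alpha> = basis_vec (H #> x) \<alpha>"
    using assms by (simp add: sum_mult_basis_vec finite_perp)
qed

lemma down_cnj: "down_H (\<lambda>\<gamma>. cnj (v \<gamma>)) = (\<lambda>\<alpha>. cnj (down_H v \<alpha>))"
  by (simp add: down_eq_fibre_sum fun_eq_iff)

lemma down_mem: "down_H v \<in> group_alg quot"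
proof -
  have "down_H v \<alpha> = 0" if "\<alpha> \<notin> carrier quot" for \<alpha>
    unfolding down_eq_fibre_sum using that by (intro sum.neutral) (auto simp: carrier_quot)
  then show ?thesis by (simp add: group_alg_def)
qed

lemma up_vec_mem: "up_H w \<in> group_alg D"
  using perp_carrier by (auto simp: up_vec_def group_alg_def)

lemma fun_linear_down: "fun_linear down_H"
  by (rule fun_linearI) (simp_all add: down_eq_fibre_sum fun_eq_iff sum.distrib sum_distrib_left)

lemma fun_linear_up_vec: "fun_linear up_H"
  by (rule fun_linearI) (simp_all add: up_vec_def fun_eq_iff)

lemma group_alg_linear_down: "group_alg_linear D quot down_H"
  by (rule group_alg_linear_if_fun_linear[OF fun_linear_down down_mem])

lemma quot_alg_eqI:
  assumes "v \<in> group_alg quot" "w \<in> group_alg quot" "\<And>x. x \<in> perp \<Longrightarrow> v (H #> x) = w (H #> x)"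
  shows "v = w"
proof
  fix \<alpha>
  show "v \<alpha> = w \<alpha>"
    using assms by (cases "\<alpha> \<in> carrier quot") (auto simp: group_alg_def carrier_quot)
qed

lemma down_up_vec:
  assumes "w \<in> group_alg quot"
  shows "down_H (up_H w) = (\<lambda>\<alpha>. of_nat (card H) * w \<alpha>)"
proof (rule quot_alg_eqI[OF down_mem group_alg_scale[OF assms]])
  show "down_H (up_H w) (H #> x) = of_nat (card H) * w (H #> x)" if "x \<in> perp" for x
    using that by (simp add: down_coset up_vec_def H_mult_perp coset_H_mult perp_carrier)
qed

lemma up_down_adjoint: "hermitian_form D x (up_H w) = hermitian_form quot (down_H x) w"
proof -
  have "hermitian_form D x (up_H w) =
      (\<Sum>\<gamma>\<in>carrier D. if \<gamma> \<in> perp then cnj (x \<gamma>) * w (H #> \<gamma>) else 0)"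
    unfolding hermitian_form_def by (intro sum.cong) (simp_all add: up_vec_def)
  also have "\<dots> = (\<Sum>\<alpha>\<in>carrier quot. \<Sum>\<gamma>\<in>{\<gamma> \<in> perp. H #> \<gamma> = \<alpha>}. cnj (x \<gamma>) * w (H #> \<gamma>))"
    by (simp only: sum_if_perp sum_perp_fibres)
  also have "\<dots> = hermitian_form quot (down_H x) w"
    by (simp add: hermitian_form_def down_eq_fibre_sum sum_distrib_right)
  finally show ?thesis .
qed

lemma up_down_self_adjoint:
  "hermitian_form D (up_H (down_H x)) y = hermitian_form D x (up_H (down_H y))"
  by (metis up_down_adjoint cnj_hermitian_form)

end

section \<open>The Weil representation and the arrow operators\<close>

definition weil_factor :: "('a, 'b) monoid_scheme \<Rightarrow> ('a \<Rightarrow> qz) \<Rightarrow> complex" where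
  "weil_factor D Q = ee (- of_int (disc_sign D Q) / 8) / of_real (sqrt (real (card (carrier D))))"

lemma weil_representation_iff:
  assumes "finite (carrier D)"
  shows "weil_representation D Q \<rho> \<longleftrightarrow>
    (\<forall>M\<in>SL2Z. group_alg_linear D D (\<rho> M)) \<and>
    (\<forall>v\<in>group_alg D. \<rho> (mat 1) v = v) \<and>
    (\<forall>M\<in>SL2Z. \<forall>N\<in>SL2Z. \<forall>v\<in>group_alg D. \<rho> (M ** N) v = \<rho> M (\<rho> N v)) \<and>
    (\<forall>\<gamma>\<in>carrier D. \<rho> matT (basis_vec \<gamma>) = (\<lambda>\<delta>. qz_ee (Q \<gamma>) * basis_vec \<gamma> \<delta>)) \<and>
    (\<forall>\<gamma>\<in>carrier D. \<rho> matS (basis_vec \<gamma>) =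
      (\<lambda>\<delta>. if \<delta> \<in> carrier D then weil_factor D Q * qz_ee (- bil D Q \<gamma> \<delta>) else 0))"
proof -
  have S: "ee (- of_int (disc_sign D Q) / 8) / of_real (sqrt (real (card (carrier D)))) *
      (\<Sum>\<beta>\<in>carrier D. qz_ee (- bil D Q \<gamma> \<beta>) * basis_vec \<beta> \<delta>) =
      (if \<delta> \<in> carrier D then weil_factor D Q * qz_ee (- bil D Q \<gamma> \<delta>) else 0)" for \<gamma> \<delta>
    by (simp add: weil_factor_def sum_mult_basis_vec[OF assms])
  show ?thesis
    unfolding weil_representation_def S group_alg_linear_def by blast
qed

context
  fixes D :: "('a, 'b) monoid_scheme" and Q :: "'a \<Rightarrow> qz" and \<rho>
  assumes fin: "finite (carrier D)" and \<rho>: "weil_representation D Q \<rho>"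
begin

lemma weil_linear: "M \<in> SL2Z \<Longrightarrow> group_alg_linear D D (\<rho> M)"
  and weil_one: "v \<in> group_alg D \<Longrightarrow> \<rho> (mat 1) v = v"
  and weil_mult: "M \<in> SL2Z \<Longrightarrow> N \<in> SL2Z \<Longrightarrow> v \<in> group_alg D \<Longrightarrow> \<rho> (M ** N) v = \<rho> M (\<rho> N v)"
  and weil_matT_basis_vec:
    "\<gamma> \<in> carrier D \<Longrightarrow> \<rho> matT (basis_vec \<gamma>) = (\<lambda>\<delta>. qz_ee (Q \<gamma>) * basis_vec \<gamma> \<delta>)"
  and weil_matS_basis_vec:
    "\<gamma> \<in> carrier D \<Longrightarrow> \<rho> matS (basis_vec \<gamma>) =
      (\<lambda>\<delta>. if \<delta> \<in> carrier D then weil_factor D Q * qz_ee (- bil D Q \<gamma> \<delta>) else 0)"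
  using \<rho> unfolding weil_representation_iff[OF fin] by blast+

lemma weil_mem: "M \<in> SL2Z \<Longrightarrow> v \<in> group_alg D \<Longrightarrow> \<rho> M v \<in> group_alg D"
  using group_alg_linear_mem[OF weil_linear] .

lemma weil_matT:
  assumes v: "v \<in> group_alg D"
  shows "\<rho> matT v = (\<lambda>\<delta>. qz_ee (Q \<delta>) * v \<delta>)"
proof -
  have "\<rho> matT v = (\<lambda>\<delta>. \<Sum>\<gamma>\<in>carrier D. (qz_ee (Q \<gamma>) * v \<gamma>) * basis_vec \<gamma> \<delta>)"
    using group_alg_linear_expand[OF weil_linear[OF matT_in_SL2Z] fin v]
    by (simp add: weil_matT_basis_vec ac_simps)
  then show ?thesis
    using v by (auto simp: sum_mult_basis_vec[OF fin] group_alg_def)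
qed

lemma weil_matS:
  assumes v: "v \<in> group_alg D" and \<delta>: "\<delta> \<in> carrier D"
  shows "\<rho> matS v \<delta> = weil_factor D Q * hermitian_form D (\<lambda>\<gamma>. qz_ee (bil D Q \<gamma> \<delta>)) v"
proof -
  have "\<rho> matS v \<delta> = (\<Sum>\<gamma>\<in>carrier D. v \<gamma> * (weil_factor D Q * qz_ee (- bil D Q \<gamma> \<delta>)))"
    using fun_cong[OF group_alg_linear_expand[OF weil_linear[OF matS_in_SL2Z] fin v], of \<delta>] \<delta>
    by (simp add: weil_matS_basis_vec)
  then show ?thesis
    by (simp add: hermitian_form_def sum_distrib_left qz_ee_minus ac_simps)
qed

lemma weil_commute_if_generators:
  assumes mem: "\<And>v. v \<in> group_alg D \<Longrightarrow> P v \<in> group_alg D"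
    and S: "\<And>v. v \<in> group_alg D \<Longrightarrow> \<rho> matS (P v) = P (\<rho> matS v)"
    and T: "\<And>v. v \<in> group_alg D \<Longrightarrow> \<rho> matT (P v) = P (\<rho> matT v)"
    and M: "M \<in> SL2Z" and v: "v \<in> group_alg D"
  shows "\<rho> M (P v) = P (\<rho> M v)"
  using M[unfolded SL2Z_eq_ST_monoid]
proof (induction rule: ST_monoid.induct)
  case one
  show ?case using v by (simp add: weil_one mem)
next
  case (matS M)
  then show ?case
    using v by (simp add: weil_mult matS_in_SL2Z ST_monoid_imp_SL2Z mem S weil_mem)
next
  case (matT M)
  then show ?case
    using v by (simp add: weil_mult matT_in_SL2Z ST_monoid_imp_SL2Z mem T weil_mem)
qed

end

context isotropic
begin

lemma weil_factor_quot: "weil_factor quot (quot_form Q) = of_nat (card H) * weil_factor D Q"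
  using card_H_pos by (simp add: weil_factor_def disc_sign_quot sqrt_card_carrier)

lemma sum_H_qz_ee_bil_left:
  assumes "x \<in> carrier D" "y \<in> carrier D"
  shows "(\<Sum>h\<in>H. qz_ee (bil D Q (h \<otimes> x) y)) =
    (if y \<in> perp then of_nat (card H) * qz_ee (bil D Q x y) else 0)"
proof -
  have "(\<Sum>h\<in>H. qz_ee (bil D Q (h \<otimes> x) y)) = (\<Sum>h\<in>H. qz_ee (bil D Q y h)) * qz_ee (bil D Q x y)"
    using assms bil_commute[of y] H_carrier
    by (simp add: bil_mult_left qz_ee_add sum_distrib_right)
  then show ?thesis using assms(2) by (simp add: character_sum_H)
qed

lemma sum_H_qz_ee_bil_right:
  assumes "x \<in> carrier D" "y \<in> carrier D"
  shows "(\<Sum>h\<in>H. qz_ee (bil D Q x (h \<otimes> y))) =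
    (if x \<in> perp then of_nat (card H) * qz_ee (bil D Q x y) else 0)"
  using sum_H_qz_ee_bil_left[OF assms(2,1)] assms by (simp add: bil_commute H_carrier)

lemma up_down_matT:
  assumes \<rho>: "weil_representation D Q \<rho>" and v: "v \<in> group_alg D"
  shows "\<rho> matT (up_H (down_H v)) = up_H (down_H (\<rho> matT v))"
  unfolding weil_matT[OF finite_carrier \<rho> v] weil_matT[OF finite_carrier \<rho> up_vec_mem]
  by (auto simp: up_vec_def down_coset Q_H_mult_perp sum_distrib_left)

lemma up_down_matS:
  assumes \<rho>: "weil_representation D Q \<rho>" and v: "v \<in> group_alg D"
  shows "\<rho> matS (up_H (down_H v)) = up_H (down_H (\<rho> matS v))"
proof
  fix \<delta>
  define \<psi> where "\<psi> \<beta> = (\<lambda>\<gamma>. qz_ee (bil D Q \<gamma> \<beta>))" for \<beta>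
  note matS = weil_matS[OF finite_carrier \<rho>, folded \<psi>_def]
  have up_down_\<psi>: "up_H (down_H (\<psi> \<delta>)) \<gamma> = (if \<delta> \<in> perp then \<Sum>h\<in>H. \<psi> (h \<otimes> \<delta>) \<gamma> else 0)"
    if "\<gamma> \<in> carrier D" "\<delta> \<in> carrier D" for \<gamma>
    using that
    by (simp add: up_vec_def down_coset \<psi>_def sum_H_qz_ee_bil_left sum_H_qz_ee_bil_right)
  show "\<rho> matS (up_H (down_H v)) \<delta> = up_H (down_H (\<rho> matS v)) \<delta>"
  proof (cases "\<delta> \<in> carrier D")
    case \<delta>: True
    have "\<rho> matS (up_H (down_H v)) \<delta> = weil_factor D Q * hermitian_form D (up_H (down_H (\<psi> \<delta>))) v"
      using \<delta> by (simp add: matS up_vec_mem up_down_self_adjoint)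
    also have "\<dots> = (if \<delta> \<in> perp
        then weil_factor D Q * (\<Sum>h\<in>H. hermitian_form D (\<psi> (h \<otimes> \<delta>)) v) else 0)"
      using \<delta> unfolding hermitian_form_def
      by (subst sum.swap) (simp add: up_down_\<psi> sum_distrib_right)
    also have "\<dots> = up_H (down_H (\<rho> matS v)) \<delta>"
      using \<delta> v by (simp add: up_vec_def down_coset matS H_carrier sum_distrib_left)
    finally show ?thesis .
  next
    case False
    moreover have "\<rho> matS (up_H (down_H v)) \<in> group_alg D"
      by (rule weil_mem[OF finite_carrier \<rho> matS_in_SL2Z up_vec_mem])
    moreover have "up_H (down_H (\<rho> matS v)) \<in> group_alg D"
      by (rule up_vec_mem)
    ultimately show ?thesis by (simp add: group_alg_def)
  qed
qed

lemma up_down_weil: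
  assumes \<rho>: "weil_representation D Q \<rho>" and "M \<in> SL2Z" "v \<in> group_alg D"
  shows "\<rho> M (up_H (down_H v)) = up_H (down_H (\<rho> M v))"
  by (rule weil_commute_if_generators[OF finite_carrier \<rho> up_vec_mem
        up_down_matS[OF \<rho>] up_down_matT[OF \<rho>] assms(2,3)])

definition down_section :: "('a set \<Rightarrow> complex) \<Rightarrow> 'a \<Rightarrow> complex" where
  "down_section w = (\<lambda>\<gamma>. 1 / of_nat (card H) * up_H w \<gamma>)"

lemma group_alg_linear_down_section: "group_alg_linear quot D down_section"
proof (rule group_alg_linear_if_fun_linear)
  show "fun_linear down_section"
    by (rule fun_linearI) (simp_all add: down_section_def up_vec_def fun_eq_iff add_divide_distrib)
  show "down_section w \<in> group_alg D" for w
    unfolding down_section_def by (rule group_alg_scale[OF up_vec_mem])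
qed

lemma down_down_section:
  assumes "w \<in> group_alg quot"
  shows "down_H (down_section w) = w"
  unfolding down_section_def group_alg_linear_scale[OF group_alg_linear_down up_vec_mem]
    down_up_vec[OF assms]
  using card_H_pos by simp

definition quot_weil ::
  "(int ^ 2 ^ 2 \<Rightarrow> ('a \<Rightarrow> complex) \<Rightarrow> 'a \<Rightarrow> complex) \<Rightarrow>
   int ^ 2 ^ 2 \<Rightarrow> ('a set \<Rightarrow> complex) \<Rightarrow> 'a set \<Rightarrow> complex"
where
  "quot_weil \<rho> M w = down_H (\<rho> M (down_section w))"

context
  fixes \<rho>
  assumes \<rho>: "weil_representation D Q \<rho>"
begin

lemma quot_weil_down:
  assumes "M \<in> SL2Z" "v \<in> group_alg D"
  shows "quot_weil \<rho> M (down_H v) = down_H (\<rho> M v)"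
proof -
  have "\<rho> M (down_section (down_H v)) = down_section (down_H (\<rho> M v))"
    unfolding down_section_def
      group_alg_linear_scale[OF weil_linear[OF finite_carrier \<rho> assms(1)] up_vec_mem]
    by (simp only: up_down_weil[OF \<rho> assms])
  then show ?thesis by (simp add: quot_weil_def down_down_section down_mem)
qed

lemma quot_weil_linear: "M \<in> SL2Z \<Longrightarrow> group_alg_linear quot quot (quot_weil \<rho> M)"
  using group_alg_linear_compose[OF group_alg_linear_compose[OF
      group_alg_linear_down_section weil_linear[OF finite_carrier \<rho>]] group_alg_linear_down]
  by (simp add: quot_weil_def[abs_def])

lemma quot_weil_one: "w \<in> group_alg quot \<Longrightarrow> quot_weil \<rho> (mat 1) w = w"
  by (simp add: quot_weil_def weil_one[OF finite_carrier \<rho>] down_down_section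
      group_alg_linear_mem[OF group_alg_linear_down_section])

lemma quot_weil_mult:
  assumes "M \<in> SL2Z" "N \<in> SL2Z" "w \<in> group_alg quot"
  shows "quot_weil \<rho> (M ** N) w = quot_weil \<rho> M (quot_weil \<rho> N w)"
proof -
  have "down_section w \<in> group_alg D"
    by (rule group_alg_linear_mem[OF group_alg_linear_down_section assms(3)])
  then show ?thesis
    using assms quot_weil_down[OF assms(1)]
    by (simp add: quot_weil_def[of _ N] quot_weil_def[of _ "M ** N"]
        weil_mult[OF finite_carrier \<rho>] weil_mem[OF finite_carrier \<rho>])
qed

lemma quot_weil_basis_vec:
  "M \<in> SL2Z \<Longrightarrow> x \<in> perp \<Longrightarrow> quot_weil \<rho> M (basis_vec (H #> x)) = down_H (\<rho> M (basis_vec x))"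
  by (simp add: quot_weil_down group_alg_basis_vec perp_carrier flip: down_basis_vec)

lemma quot_weil_matT:
  assumes "\<alpha> \<in> carrier quot"
  shows "quot_weil \<rho> matT (basis_vec \<alpha>) = (\<lambda>\<delta>. qz_ee (quot_form Q \<alpha>) * basis_vec \<alpha> \<delta>)"
proof -
  from assms obtain x where x: "x \<in> perp" "\<alpha> = H #> x" by (auto simp: carrier_quot)
  then have "quot_weil \<rho> matT (basis_vec \<alpha>) = down_H (\<lambda>\<delta>. qz_ee (Q x) * basis_vec x \<delta>)"
    by (simp add: quot_weil_basis_vec matT_in_SL2Z weil_matT_basis_vec[OF finite_carrier \<rho>]
        perp_carrier)
  then show ?thesis
    using group_alg_linear_scale[OF group_alg_linear_down group_alg_basis_vec] x
    by (simp add: perp_carrier down_basis_vec quot_form_coset)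
qed

lemma quot_weil_matS:
  assumes "\<alpha> \<in> carrier quot"
  shows "quot_weil \<rho> matS (basis_vec \<alpha>) = (\<lambda>\<delta>. if \<delta> \<in> carrier quot
    then weil_factor quot (quot_form Q) * qz_ee (- bil quot (quot_form Q) \<alpha> \<delta>) else 0)"
    (is "_ = ?rhs")
proof (rule quot_alg_eqI)
  from assms obtain x where x: "x \<in> perp" "\<alpha> = H #> x" by (auto simp: carrier_quot)
  show "quot_weil \<rho> matS (basis_vec \<alpha>) \<in> group_alg quot"
    unfolding quot_weil_def by (rule down_mem)
  show "?rhs \<in> group_alg quot"
    by (simp add: group_alg_def)
  show "quot_weil \<rho> matS (basis_vec \<alpha>) (H #> y) = ?rhs (H #> y)" if y: "y \<in> perp" for y
  proof -
    have "quot_weil \<rho> matS (basis_vec \<alpha>) (H #> y) =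
        weil_factor D Q * (\<Sum>h\<in>H. qz_ee (- bil D Q x (h \<otimes> y)))"
      using x y
      by (simp add: quot_weil_basis_vec matS_in_SL2Z weil_matS_basis_vec[OF finite_carrier \<rho>]
          down_coset perp_carrier H_carrier sum_distrib_left)
    also have "\<dots> = of_nat (card H) * weil_factor D Q * qz_ee (- bil D Q x y)"
      using x y sum_H_qz_ee_bil_right[of x y]
      by (simp add: qz_ee_minus perp_carrier flip: cnj_sum)
    finally show ?thesis
      using x y by (simp add: weil_factor_quot bil_quot carrier_quot)
  qed
qed

lemma weil_representation_quot: "weil_representation quot (quot_form Q) (quot_weil \<rho>)"
  unfolding weil_representation_iff[OF finite_quot]
  using quot_weil_linear quot_weil_one quot_weil_mult quot_weil_matT quot_weil_matS by blast

end

end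

section \<open>Modular forms and intertwining operators\<close>

definition bounded_at_cusp :: "(complex \<Rightarrow> complex) \<Rightarrow> bool" where
  "bounded_at_cusp f \<longleftrightarrow> (\<exists>B y. \<forall>\<tau>\<in>upper_half_plane. Im \<tau> \<ge> y \<longrightarrow> norm (f \<tau>) \<le> B)"

lemma bounded_at_cusp_mult_right:
  assumes "bounded_at_cusp f"
  shows "bounded_at_cusp (\<lambda>\<tau>. f \<tau> * c)"
proof -
  from assms obtain B y where "\<forall>\<tau>\<in>upper_half_plane. Im \<tau> \<ge> y \<longrightarrow> norm (f \<tau>) \<le> B"
    unfolding bounded_at_cusp_def by blast
  then have "\<forall>\<tau>\<in>upper_half_plane. Im \<tau> \<ge> y \<longrightarrow> norm (f \<tau> * c) \<le> B * norm c"
    by (simp add: norm_mult mult_right_mono)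
  then show ?thesis unfolding bounded_at_cusp_def by blast
qed

lemma bounded_at_cusp_add:
  assumes "bounded_at_cusp f" "bounded_at_cusp g"
  shows "bounded_at_cusp (\<lambda>\<tau>. f \<tau> + g \<tau>)"
proof -
  from assms obtain B y C z where
    "\<forall>\<tau>\<in>upper_half_plane. Im \<tau> \<ge> y \<longrightarrow> norm (f \<tau>) \<le> B"
    "\<forall>\<tau>\<in>upper_half_plane. Im \<tau> \<ge> z \<longrightarrow> norm (g \<tau>) \<le> C"
    unfolding bounded_at_cusp_def by blast
  then have "\<forall>\<tau>\<in>upper_half_plane. Im \<tau> \<ge> max y z \<longrightarrow> norm (f \<tau> + g \<tau>) \<le> B + C"
    by (auto intro: norm_triangle_mono)
  then show ?thesis unfolding bounded_at_cusp_def by blast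
qed

lemma bounded_at_cusp_sum:
  assumes "finite J" "\<And>j. j \<in> J \<Longrightarrow> bounded_at_cusp (f j)"
  shows "bounded_at_cusp (\<lambda>\<tau>. \<Sum>j\<in>J. f j \<tau>)"
  using assms
proof (induction J rule: finite_induct)
  case empty
  show ?case by (auto simp: bounded_at_cusp_def)
next
  case (insert j J)
  then show ?case by (simp add: bounded_at_cusp_add)
qed

lemma bounded_at_cusp_cong:
  "(\<And>\<tau>. \<tau> \<in> upper_half_plane \<Longrightarrow> f \<tau> = g \<tau>) \<Longrightarrow> bounded_at_cusp f \<longleftrightarrow> bounded_at_cusp g"
  by (simp add: bounded_at_cusp_def)

abbreviation automorphy_factor :: "int ^ 2 ^ 2 \<Rightarrow> complex \<Rightarrow> complex" where
  "automorphy_factor M \<tau> \<equiv> of_int (M $ 2 $ 1) * \<tau> + of_int (M $ 2 $ 2)"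

lemma modular_forms_iff:
  "F \<in> modular_forms k D Q \<longleftrightarrow>
     (\<forall>\<tau>\<in>upper_half_plane. F \<tau> \<in> group_alg D) \<and>
     (\<forall>\<gamma>\<in>carrier D. (\<lambda>\<tau>. F \<tau> \<gamma>) holomorphic_on upper_half_plane) \<and>
     (\<exists>\<rho>. weil_representation D Q \<rho> \<and>
        (\<forall>M\<in>SL2Z. \<forall>\<tau>\<in>upper_half_plane.
           F (moebius_act M \<tau>) = (\<lambda>\<gamma>. automorphy_factor M \<tau> powi k * \<rho> M (F \<tau>) \<gamma>))) \<and>
     (\<forall>\<gamma>\<in>carrier D. bounded_at_cusp (\<lambda>\<tau>. F \<tau> \<gamma>))"
  by (simp add: modular_forms_def bounded_at_cusp_def)

lemma modular_forms_mem:
  "F \<in> modular_forms k D Q \<Longrightarrow> \<tau> \<in> upper_half_plane \<Longrightarrow> F \<tau> \<in> group_alg D"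
  by (simp add: modular_forms_iff)

text \<open>As the Weil representation is unique on \<open>\<complex>[D]\<close>, quantifying over all \<open>\<rho>\<close> is harmless.\<close>

definition weil_intertwiner ::
  "('a, 'b) monoid_scheme \<Rightarrow> ('a \<Rightarrow> qz) \<Rightarrow> ('c, 'd) monoid_scheme \<Rightarrow> ('c \<Rightarrow> qz) \<Rightarrow>
   (('a \<Rightarrow> complex) \<Rightarrow> 'c \<Rightarrow> complex) \<Rightarrow> bool"
where
  "weil_intertwiner D Q E R L \<longleftrightarrow> group_alg_linear D E L \<and>
     (\<forall>\<rho>. weil_representation D Q \<rho> \<longrightarrow> (\<exists>\<rho>'. weil_representation E R \<rho>' \<and>
        (\<forall>M\<in>SL2Z. \<forall>v\<in>group_alg D. \<rho>' M (L v) = L (\<rho> M v))))"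

lemma modular_forms_intertwiner:
  assumes fin: "finite (carrier D)" and F: "F \<in> modular_forms k D Q"
    and L: "weil_intertwiner D Q E R L"
  shows "(\<lambda>\<tau>. L (F \<tau>)) \<in> modular_forms k E R"
proof -
  note mem = modular_forms_mem[OF F]
  have lin: "group_alg_linear D E L"
    using L by (simp add: weil_intertwiner_def)
  have expand: "L (F \<tau>) \<delta> = (\<Sum>\<gamma>\<in>carrier D. F \<tau> \<gamma> * L (basis_vec \<gamma>) \<delta>)"
    if "\<tau> \<in> upper_half_plane" for \<tau> \<delta>
    using fun_cong[OF group_alg_linear_expand[OF lin fin mem[OF that]]] .
  have holomorphic: "(\<lambda>\<tau>. L (F \<tau>) \<delta>) holomorphic_on upper_half_plane" for \<delta>
  proof -
    have "(\<lambda>\<tau>. \<Sum>\<gamma>\<in>carrier D. F \<tau> \<gamma> * L (basis_vec \<gamma>) \<delta>) holomorphic_on upper_half_plane"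
      using F by (intro holomorphic_intros) (simp add: modular_forms_iff)
    then show ?thesis by (simp add: expand cong: holomorphic_cong)
  qed
  have bounded: "bounded_at_cusp (\<lambda>\<tau>. L (F \<tau>) \<delta>)" for \<delta>
  proof -
    have "bounded_at_cusp (\<lambda>\<tau>. \<Sum>\<gamma>\<in>carrier D. F \<tau> \<gamma> * L (basis_vec \<gamma>) \<delta>)"
      using F
      by (intro bounded_at_cusp_sum bounded_at_cusp_mult_right fin) (simp add: modular_forms_iff)
    then show ?thesis by (simp add: expand cong: bounded_at_cusp_cong)
  qed
  obtain \<rho> where \<rho>: "weil_representation D Q \<rho>"
    and F_transform: "\<And>M \<tau>. M \<in> SL2Z \<Longrightarrow> \<tau> \<in> upper_half_plane \<Longrightarrow>
      F (moebius_act M \<tau>) = (\<lambda>\<gamma>. automorphy_factor M \<tau> powi k * \<rho> M (F \<tau>) \<gamma>)"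
    using F by (auto simp: modular_forms_iff)
  obtain \<rho>' where \<rho>': "weil_representation E R \<rho>'"
    and intertwine: "\<And>M v. M \<in> SL2Z \<Longrightarrow> v \<in> group_alg D \<Longrightarrow> \<rho>' M (L v) = L (\<rho> M v)"
    using L \<rho> unfolding weil_intertwiner_def by blast
  have "L (F (moebius_act M \<tau>)) = (\<lambda>\<gamma>. automorphy_factor M \<tau> powi k * \<rho>' M (L (F \<tau>)) \<gamma>)"
    if "M \<in> SL2Z" "\<tau> \<in> upper_half_plane" for M \<tau>
    using that
    by (simp add: F_transform intertwine mem group_alg_linear_scale[OF lin weil_mem[OF fin \<rho>]])
  then show ?thesis
    unfolding modular_forms_iff
    using group_alg_linear_mem[OF lin mem] holomorphic \<rho>' bounded by blast
qed

lemma (in isotropic) weil_intertwiner_down: "weil_intertwiner D Q quot (quot_form Q) down_H"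
  unfolding weil_intertwiner_def
  using group_alg_linear_down weil_representation_quot quot_weil_down by blast

section \<open>Oldforms\<close>

lemma form_map_eq_hermitian_form: "form_map D F v \<tau> = hermitian_form D (\<lambda>\<gamma>. cnj (v \<gamma>)) (F \<tau>)"
  by (simp add: form_map_def hermitian_form_def)

locale isotropic_family = disc_form +
  fixes n :: nat and H :: "nat \<Rightarrow> 'a set"
  assumes iso: "i \<in> {1..n} \<Longrightarrow> isotropic_subgroup D Q (H i)"
begin

lemma isotropic_H: "i \<in> {1..n} \<Longrightarrow> isotropic D Q (H i)"
  by unfold_locales (rule iso)

lemma ker_down_cnj: "v \<in> ker_down D Q n H \<Longrightarrow> (\<lambda>\<gamma>. cnj (v \<gamma>)) \<in> ker_down D Q n H"
  by (simp add: ker_down_def group_alg_cnj isotropic.down_cnj[OF isotropic_H])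

lemma ker_down_subset_ker_form_map_iff:
  "ker_down D Q n H \<subseteq> ker_form_map D F \<longleftrightarrow>
   (\<forall>v\<in>ker_down D Q n H. \<forall>\<tau>\<in>upper_half_plane. hermitian_form D v (F \<tau>) = 0)"
proof -
  have "ker_down D Q n H \<subseteq> ker_form_map D F \<longleftrightarrow>
      (\<forall>v\<in>ker_down D Q n H. \<forall>\<tau>\<in>upper_half_plane. hermitian_form D (\<lambda>\<gamma>. cnj (v \<gamma>)) (F \<tau>) = 0)"
    by (auto simp: ker_form_map_def ker_down_def form_map_eq_hermitian_form)
  also have "\<dots> \<longleftrightarrow> (\<forall>v\<in>ker_down D Q n H. \<forall>\<tau>\<in>upper_half_plane. hermitian_form D v (F \<tau>) = 0)"
    using ker_down_cnj by force
  finally show ?thesis .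
qed

definition up_sum :: "(nat \<Rightarrow> 'a set \<Rightarrow> complex) \<Rightarrow> 'a \<Rightarrow> complex" where
  "up_sum w = (\<lambda>\<gamma>. \<Sum>i=1..n. up_vec D Q (H i) (w i) \<gamma>)"

lemma oldform_iff:
  "oldform k D Q n H F \<longleftrightarrow>
   (\<exists>G. (\<forall>i\<in>{1..n}. G i \<in> modular_forms k (quot_group D Q (H i)) (quot_form Q)) \<and>
        (\<forall>\<tau>\<in>upper_half_plane. F \<tau> = up_sum (\<lambda>i. G i \<tau>)))"
  by (simp add: oldform_def up_sum_def isotropic.up_eq_up_vec[OF isotropic_H])

lemma hermitian_form_up_sum:
  "hermitian_form D v (up_sum w) =
   (\<Sum>i=1..n. hermitian_form (quot_group D Q (H i)) (down D Q (H i) v) (w i))"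
  by (simp add: up_sum_def hermitian_form_sum_right isotropic.up_down_adjoint[OF isotropic_H])

lemma hermitian_form_ker_down_up_sum:
  "v \<in> ker_down D Q n H \<Longrightarrow> hermitian_form D v (up_sum w) = 0"
  by (simp add: hermitian_form_up_sum ker_down_def) (simp add: hermitian_form_def)

definition down_gram :: "('a \<Rightarrow> complex) \<Rightarrow> 'a \<Rightarrow> complex" where
  "down_gram v = up_sum (\<lambda>i. down D Q (H i) v)"

lemma down_gram_mem: "down_gram v \<in> group_alg D"
  using isotropic.up_vec_mem[OF isotropic_H]
  by (simp add: down_gram_def up_sum_def group_alg_def)

lemma fun_linear_down_gram: "fun_linear down_gram"
proof -
  have "fun_linear (\<lambda>v. up_vec D Q (H i) (down D Q (H i) v))" if "i \<in> {1..n}" for i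
    using Vector_Spaces.linear_compose[OF
        isotropic.fun_linear_down[OF isotropic_H[OF that]]
        isotropic.fun_linear_up_vec[OF isotropic_H[OF that]]]
    by (simp add: o_def)
  then have "fun_linear (\<lambda>v. \<Sum>i=1..n. up_vec D Q (H i) (down D Q (H i) v))"
    by (intro vector_space_pair.linear_compose_sum)
      (auto simp: vector_space_pair_def fun_space.vector_space_axioms)
  moreover have "down_gram = (\<lambda>v. \<Sum>i=1..n. up_vec D Q (H i) (down D Q (H i) v))"
    by (simp add: fun_eq_iff down_gram_def up_sum_def sum_fun_apply)
  ultimately show ?thesis by simp
qed

lemma down_gram_self_adjoint:
  "hermitian_form D (down_gram x) y = hermitian_form D x (down_gram y)"
proof -
  have "hermitian_form D (down_gram x) y = cnj (hermitian_form D y (down_gram x))"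
    by (rule cnj_hermitian_form[symmetric])
  then show ?thesis
    by (simp add: down_gram_def hermitian_form_up_sum cnj_hermitian_form)
qed

lemma down_gram_eq_0_imp_ker_down:
  assumes v: "v \<in> group_alg D" and "down_gram v = (\<lambda>_. 0)"
  shows "v \<in> ker_down D Q n H"
proof -
  define s where "s i = (\<Sum>\<alpha>\<in>carrier (quot_group D Q (H i)). (norm (down D Q (H i) v \<alpha>))\<^sup>2)" for i
  have "of_real (\<Sum>i=1..n. s i) = hermitian_form D v (down_gram v)"
    by (simp add: down_gram_def hermitian_form_up_sum hermitian_form_self s_def)
  also have "\<dots> = 0" by (simp add: assms(2) hermitian_form_def)
  finally have "(\<Sum>i=1..n. s i) = 0" using of_real_eq_0_iff by blast
  then have "s i = 0" if "i \<in> {1..n}" for i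
    using that by (simp add: sum_nonneg_eq_0_iff sum_nonneg s_def)
  then have "hermitian_form (quot_group D Q (H i)) (down D Q (H i) v) (down D Q (H i) v) = 0"
    if "i \<in> {1..n}" for i
    using that by (simp add: hermitian_form_self s_def)
  then have "down D Q (H i) v = (\<lambda>_. 0)" if "i \<in> {1..n}" for i
    using that hermitian_form_self_eq_0_iff isotropic.finite_quot isotropic.down_mem isotropic_H
    by blast
  then show ?thesis using v by (simp add: ker_down_def)
qed

sublocale down_gram: index_one_operator fun_scale down_gram
proof -
  have "\<exists>B. finite B \<and> range down_gram \<subseteq> fun_space.span B"
    using group_alg_subset_span[OF finite_carrier] down_gram_mem finite_carrier
    by (intro exI[of _ "basis_vec ` carrier D"]) auto
  moreover have "down_gram x = 0" if "down_gram (down_gram x) = 0" for x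
  proof -
    have "hermitian_form D (down_gram x) (down_gram x) =
        hermitian_form D x (down_gram (down_gram x))"
      by (rule down_gram_self_adjoint)
    also have "\<dots> = 0" using that by (simp add: hermitian_form_def)
    finally show ?thesis
      by (simp add: hermitian_form_self_eq_0_iff[OF finite_carrier down_gram_mem] zero_fun_def)
  qed
  ultimately show "index_one_operator fun_scale down_gram"
    using fun_linear_down_gram
    by (simp add: index_one_operator_def index_one_operator_axioms_def)
qed

lemma down_gram_weil:
  assumes \<rho>: "weil_representation D Q \<rho>" and M: "M \<in> SL2Z" and v: "v \<in> group_alg D"
  shows "\<rho> M (down_gram v) = down_gram (\<rho> M v)"
  using group_alg_linear_sum[OF weil_linear[OF finite_carrier \<rho> M], of "{1..n}"
      "\<lambda>i. up_vec D Q (H i) (down D Q (H i) v)" "\<lambda>_. 1"]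
  by (simp add: down_gram_def up_sum_def isotropic.up_vec_mem[OF isotropic_H]
      isotropic.up_down_weil[OF isotropic_H \<rho> M v])

lemma weil_intertwiner_group_inverse:
  "weil_intertwiner D Q D Q (group_inverse down_gram)"
proof -
  have "group_alg_linear D D (group_inverse down_gram)"
    using down_gram.group_inverse_in_range down_gram_mem
    by (intro group_alg_linear_if_fun_linear down_gram.linear_group_inverse) (metis imageE)
  moreover have "\<rho> M (group_inverse down_gram v) = group_inverse down_gram (\<rho> M v)"
    if "weil_representation D Q \<rho>" "M \<in> SL2Z" "v \<in> group_alg D" for \<rho> M v
    using that down_gram_mem
    by (intro down_gram.group_inverse_commute[of "group_alg D", symmetric])
      (auto simp: down_gram_weil weil_mem[OF finite_carrier])
  ultimately show ?thesis
    unfolding weil_intertwiner_def by blast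
qed

lemma down_gram_group_inverse:
  assumes y: "y \<in> group_alg D"
    and orthogonal: "\<And>v. v \<in> ker_down D Q n H \<Longrightarrow> hermitian_form D v y = 0"
  shows "down_gram (group_inverse down_gram y) = y"
proof -
  define w where "w = y - down_gram (group_inverse down_gram y)"
  have w: "w \<in> group_alg D"
    using y down_gram_mem by (simp add: w_def group_alg_def)
  have ker: "down_gram w = (\<lambda>_. 0)"
    by (simp add: w_def down_gram.diff down_gram.f_f_group_inverse zero_fun_def)
  have "hermitian_form D w (down_gram (group_inverse down_gram y)) = 0"
    unfolding down_gram_self_adjoint[symmetric] ker by (simp add: hermitian_form_def)
  moreover have "hermitian_form D w y = 0"
    by (rule orthogonal[OF down_gram_eq_0_imp_ker_down[OF w ker]])
  ultimately have "hermitian_form D w (y - down_gram (group_inverse down_gram y)) = 0"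
    by (simp add: hermitian_form_diff_right)
  then have "w = (\<lambda>_. 0)"
    using hermitian_form_self_eq_0_iff[OF finite_carrier w] by (simp add: w_def)
  then show ?thesis by (simp add: w_def fun_eq_iff)
qed

lemma oldform_imp_ker_down_subset:
  "oldform k D Q n H F \<Longrightarrow> ker_down D Q n H \<subseteq> ker_form_map D F"
  by (auto simp: oldform_iff ker_down_subset_ker_form_map_iff hermitian_form_ker_down_up_sum)

lemma ker_down_subset_imp_oldform:
  assumes F: "F \<in> modular_forms k D Q" and "ker_down D Q n H \<subseteq> ker_form_map D F"
  shows "oldform k D Q n H F"
proof -
  define B where "B = group_inverse down_gram"
  define G where "G i \<tau> = down D Q (H i) (B (F \<tau>))" for i \<tau>
  have BF: "(\<lambda>\<tau>. B (F \<tau>)) \<in> modular_forms k D Q"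
    unfolding B_def
    by (rule modular_forms_intertwiner[OF finite_carrier F weil_intertwiner_group_inverse])
  have "G i \<in> modular_forms k (quot_group D Q (H i)) (quot_form Q)" if "i \<in> {1..n}" for i
    unfolding G_def
    by (rule modular_forms_intertwiner[OF finite_carrier BF
          isotropic.weil_intertwiner_down[OF isotropic_H[OF that]]])
  moreover have "F \<tau> = up_sum (\<lambda>i. G i \<tau>)" if \<tau>: "\<tau> \<in> upper_half_plane" for \<tau>
  proof -
    have "down_gram (B (F \<tau>)) = F \<tau>"
      unfolding B_def using assms(2) \<tau>
      by (intro down_gram_group_inverse modular_forms_mem[OF F])
        (simp_all add: ker_down_subset_ker_form_map_iff)
    then show ?thesis by (simp add: G_def down_gram_def)
  qed
  ultimately show ?thesis
    unfolding oldform_iff by blast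
qed

end

theorem theorem4p4:
  fixes D :: "'a monoid" and Q :: "'a \<Rightarrow> qz" and k :: int
    and n :: nat and H :: "nat \<Rightarrow> 'a set" and F :: "complex \<Rightarrow> 'a \<Rightarrow> complex"
  assumes "discriminant_form D Q"
    and "even_signature D Q"
    and "\<And>i. i \<in> {1..n} \<Longrightarrow> isotropic_subgroup D Q (H i)"
    and "F \<in> modular_forms k D Q"
  shows "oldform k D Q n H F \<longleftrightarrow> ker_down D Q n H \<subseteq> ker_form_map D F"
proof -
  interpret isotropic_family D Q n H
    by unfold_locales (rule assms)+
  show ?thesis
    using oldform_imp_ker_down_subset ker_down_subset_imp_oldform[OF assms(4)] by blast
qed

end
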